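(* Let $(T_j)_{j\in\mathbb{N}}$ be random tessellations of $\mathbb{R}^2$ and let $R_j^{(2)}$ denote the second order partition process of $T_j$. For each $j\in\mathbb{N}$ let $C_j=\{C_j(\mathbf{x}):\mathbf{x}\in\mathbb{R}^2\}$ be a real valued random field, the fields $C_j$ being independent of the tessellations $(T_j)$, and let $I_j$ be the colored tessellation process associated to $T_j$ and $C_j$. Assume that (i) there exists a random process $R_\infty^{(2)}$ with values in $\{0,1\}^{(\mathbb{R}^2)^2}$ such that $R_j^{(2)}\to R_\infty^{(2)}$ in the sense of finite-dimensional distributions as $j\to\infty$; (ii) there exists a random field $C_\infty$ with values in $\mathbb{R}^{\mathbb{R}^2}$ such that $C_j\to C_\infty$ in the sense of finite-dimensional distributions as $j\to\infty$. Then there exists a random field $I_\infty=\{I_\infty(\mathbf{x}):\mathbf{x}\in\mathbb{R}^2\}$ such that $I_j\to I_\infty$ in the sense of finite-dimensional distributions. Furthermore the finite-dimensional distributions of $I_\infty$ depend only on those of $R_\infty^{(2)}$ and $C_\infty$.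
   Context: Let $\mathcal{F}$ be the set of closed subsets of $\mathbb{R}^2$, with the Borel $\sigma$-field of the Fell topology (the topology generated by the sets $\{F: F\cap K=\emptyset\}$, $K$ compact, and $\{F:F\cap G\ne\emptyset\}$, $G$ open). A tessellation of $\mathbb{R}^2$ is a collection $T=\{F_i\}_{i\in\mathbb{N}}$ of closed sets with: (1) $\bigcup_i F_i=\mathbb{R}^2$; (2) the interiors $\mathring F_i,\mathring F_j$ are disjoint for $i\neq j$; (3) for every bounded $A\subset\mathbb{R}^2$, only finitely many $i$ satisfy $F_i\cap A\neq\emptyset$. Its boundary is $\partial T=\bigcup_i\partial F_i$, $\partial F_i$ being the topological boundary. A random tessellation is a measurable map from a probability space to $\mathcal{F}^{\mathbb{N}}$ (product $\sigma$-field) that is almost surely a tessellation. Second order partition process of $T$: for $\mathbf{x},\mathbf{y}\in\mathbb{R}^2$, $R^{(2)}(\mathbf{x},\mathbf{y})=1$ if there is $i$ with $\mathbf{x},\mathbf{y}\in\mathring F_i\setminus\partial T$, and $R^{(2)}(\mathbf{x},\mathbf{y})=0$ otherwise. Colored tessellation process associated to a random tessellation $T=\{F_i\}$ and a real valued random field $C$: let $(C_i)_i$ be independent copies of $C$ (as random fields on $\mathbb{R}^2$), independent of $T$. For $\mathbf{x}\notin\partial T$ let $i(\mathbf{x})$ be the unique index with $\mathbf{x}\in\mathring F_{i(\mathbf{x})}$. Then $I(\mathbf{x})=C_{i(\mathbf{x})}(\mathbf{x})$ if $\mathbf{x}\notin\partial T$ and $I(\mathbf{x})=0$ if $\mathbf{x}\in\partial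 T$. Convergence in the sense of finite-dimensional distributions means convergence in distribution of the finite-dimensional vectors obtained by evaluating the process at any finite set of points of its index set. *)

theory Defs
  imports "HOL-Probability.Probability"
begin

subsection \<open>Random closed sets and random tessellations of the plane\<close>

(* The subbasic sets are restricted to closed F; taking K = {} shows that the
   underlying set of the generated topology is the set of all closed sets. *)
definition fell_topology :: "(real^2) set topology" where
  "fell_topology = topology_generated_by
     ({{F. closed F \<and> F \<inter> K = {}} | K. compact K} \<union>
      {{F. closed F \<and> F \<inter> G \<noteq> {}} | G. open G})"

definition fell_borel :: "(real^2) set measure" where
  "fell_borel = sigma (topspace fell_topology) {U. openin fell_topology U}"

lemma topspace_fell_topology: "topspace fell_topology = {F. closed F}"
proof (rule equalityI)
  show "topspace fell_topology \<subseteq> {F. closed F}"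
    unfolding fell_topology_def topology_generated_by_topspace by auto
  show "{F. closed F} \<subseteq> topspace fell_topology"
    unfolding fell_topology_def topology_generated_by_topspace
  proof (rule Union_upper, rule UnI1, rule CollectI, intro exI conjI)
    show "{F :: (real^2) set. closed F} = {F. closed F \<and> F \<inter> {} = {}}" by simp
  qed (rule compact_empty)
qed

definition tessellation :: "(nat \<Rightarrow> (real^2) set) \<Rightarrow> bool" where
  "tessellation F \<longleftrightarrow>
     (\<forall>i. closed (F i)) \<and>
     (\<Union>i. F i) = UNIV \<and>
     (\<forall>i j. i \<noteq> j \<longrightarrow> interior (F i) \<inter> interior (F j) = {}) \<and>
     (\<forall>A. bounded A \<longrightarrow> finite {i. F i \<inter> A \<noteq> {}})"

definition tess_boundary :: "(nat \<Rightarrow> (real^2) set) \<Rightarrow> (real^2) set" where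
  "tess_boundary F = (\<Union>i. frontier (F i))"

definition random_tessellation :: "'a measure \<Rightarrow> ('a \<Rightarrow> nat \<Rightarrow> (real^2) set) \<Rightarrow> bool" where
  "random_tessellation M T \<longleftrightarrow>
     prob_space M \<and> T \<in> M \<rightarrow>\<^sub>M PiM UNIV (\<lambda>_. fell_borel) \<and> (AE \<omega> in M. tessellation (T \<omega>))"

text \<open>The second order partition process, as a process indexed by pairs of points.\<close>

definition partition2 :: "(nat \<Rightarrow> (real^2) set) \<Rightarrow> (real^2) \<times> (real^2) \<Rightarrow> real" where
  "partition2 F p =
     (if \<exists>i. fst p \<in> interior (F i) - tess_boundary F \<and> snd p \<in> interior (F i) - tess_boundary F
      then 1 else 0)"


subsection \<open>Random fields and convergence of finite-dimensional distributions\<close>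

abbreviation field_space :: "('i \<Rightarrow> real) measure" where
  "field_space \<equiv> PiM UNIV (\<lambda>_. borel)"

definition random_field :: "'a measure \<Rightarrow> ('a \<Rightarrow> 'i \<Rightarrow> real) \<Rightarrow> bool" where
  "random_field M X \<longleftrightarrow> prob_space M \<and> X \<in> M \<rightarrow>\<^sub>M field_space"

definition fdd :: "'a measure \<Rightarrow> ('a \<Rightarrow> 'i \<Rightarrow> real) \<Rightarrow> 'i set \<Rightarrow> ('i \<Rightarrow> real) measure" where
  "fdd M X J = distr M (PiM J (\<lambda>_. borel)) (\<lambda>\<omega>. restrict (X \<omega>) J)"

definition same_fdds ::
  "'a measure \<Rightarrow> ('a \<Rightarrow> 'i \<Rightarrow> real) \<Rightarrow> 'b measure \<Rightarrow> ('b \<Rightarrow> 'i \<Rightarrow> real) \<Rightarrow> bool" where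
  "same_fdds M X N Y \<longleftrightarrow> (\<forall>J. finite J \<longrightarrow> fdd M X J = fdd N Y J)"

definition weakly_converges :: "'b topology \<Rightarrow> (nat \<Rightarrow> 'b measure) \<Rightarrow> 'b measure \<Rightarrow> bool" where
  "weakly_converges X \<mu> \<nu> \<longleftrightarrow>
     (\<forall>f. continuous_map X euclideanreal f \<and> bounded (f ` topspace X) \<longrightarrow>
        (\<lambda>j. \<integral>z. f z \<partial>\<mu> j) \<longlonglongrightarrow> (\<integral>z. f z \<partial>\<nu>))"

text \<open>The processes of the sequence may live on different probability spaces.\<close>

definition fdd_converges ::
  "(nat \<Rightarrow> 'a measure) \<Rightarrow> (nat \<Rightarrow> 'a \<Rightarrow> 'i \<Rightarrow> real) \<Rightarrow> 'b measure \<Rightarrow> ('b \<Rightarrow> 'i \<Rightarrow> real) \<Rightarrow> bool" where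
  "fdd_converges M X N Y \<longleftrightarrow>
     (\<forall>J. finite J \<longrightarrow>
        weakly_converges (product_topology (\<lambda>_. euclideanreal) J) (\<lambda>j. fdd (M j) (X j) J) (fdd N Y J))"


subsection \<open>Colored tessellation processes\<close>

(* The library's indep_var requires both random elements to have the same value type. *)
definition independent_elements ::
  "'a measure \<Rightarrow> 'b measure \<Rightarrow> ('a \<Rightarrow> 'b) \<Rightarrow> 'c measure \<Rightarrow> ('a \<Rightarrow> 'c) \<Rightarrow> bool" where
  "independent_elements M S X S' Y \<longleftrightarrow>
     X \<in> M \<rightarrow>\<^sub>M S \<and> Y \<in> M \<rightarrow>\<^sub>M S' \<and>
     prob_space.indep_set M {X -` A \<inter> space M | A. A \<in> sets S} {Y -` B \<inter> space M | B. B \<in> sets S'}"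

(* For a tessellation the second conjunct of the condition follows from the first (next
   lemma). It is only relevant on the null event where F is not a tessellation: there an
   unguarded THE would be unspecified, possibly in a non-measurable way. *)
definition colored :: "(nat \<Rightarrow> (real^2) set) \<Rightarrow> (nat \<Rightarrow> real^2 \<Rightarrow> real) \<Rightarrow> real^2 \<Rightarrow> real" where
  "colored F c x =
     (if x \<notin> tess_boundary F \<and> (\<exists>!i. x \<in> interior (F i))
      then c (THE i. x \<in> interior (F i)) x else 0)"

lemma tessellation_ex1_cell:
  assumes "tessellation F" "x \<notin> tess_boundary F"
  shows "\<exists>!i. x \<in> interior (F i)"
proof -
  have "x \<in> (\<Union>i. F i)"
    using assms(1) by (simp add: tessellation_def)
  then obtain i where "x \<in> F i"
    by blast
  then have i: "x \<in> interior (F i)"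
    using assms closure_subset[of "F i"] by (auto simp: tess_boundary_def frontier_def)
  show ?thesis
  proof (rule ex1I)
    show "x \<in> interior (F i)" by (fact i)
  next
    fix j assume "x \<in> interior (F j)"
    then show "j = i"
      using i assms(1) unfolding tessellation_def by blast
  qed
qed

definition colored_process ::
  "'a measure \<Rightarrow> ('a \<Rightarrow> nat \<Rightarrow> (real^2) set) \<Rightarrow> ('a \<Rightarrow> real^2 \<Rightarrow> real) \<Rightarrow> ('a \<Rightarrow> real^2 \<Rightarrow> real) \<Rightarrow> bool"
where
  "colored_process M T C I \<longleftrightarrow>
     (\<exists>Cc :: nat \<Rightarrow> 'a \<Rightarrow> real^2 \<Rightarrow> real.
        (\<forall>i. Cc i \<in> M \<rightarrow>\<^sub>M field_space \<and> distr M field_space (Cc i) = distr M field_space C) \<and>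
        prob_space.indep_vars M (\<lambda>_. field_space) Cc UNIV \<and>
        independent_elements M (PiM UNIV (\<lambda>_. fell_borel)) T
          (PiM UNIV (\<lambda>_. field_space)) (\<lambda>\<omega> i. Cc i \<omega>) \<and>
        (\<forall>\<omega>\<in>space M. I \<omega> = colored (T \<omega>) (\<lambda>i. Cc i \<omega>)))"

text \<open>The hypotheses on the sequence and on the limits of the partition processes and fields.
  The objects with index \<open>j\<close> live on \<open>M j\<close>; a common probability space is the case of
  constant \<open>M\<close>.\<close>

definition converging_coloring ::
  "(nat \<Rightarrow> 'a measure) \<Rightarrow> (nat \<Rightarrow> 'a \<Rightarrow> nat \<Rightarrow> (real^2) set) \<Rightarrow> (nat \<Rightarrow> 'a \<Rightarrow> real^2 \<Rightarrow> real) \<Rightarrow>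
   (nat \<Rightarrow> 'a \<Rightarrow> real^2 \<Rightarrow> real) \<Rightarrow> 'r measure \<Rightarrow> ('r \<Rightarrow> (real^2) \<times> (real^2) \<Rightarrow> real) \<Rightarrow>
   'c measure \<Rightarrow> ('c \<Rightarrow> real^2 \<Rightarrow> real) \<Rightarrow> bool"
where
  "converging_coloring M T C I MR Rlim MC Clim \<longleftrightarrow>
     (\<forall>j. random_tessellation (M j) (T j) \<and> random_field (M j) (C j) \<and>
        independent_elements (M j) (PiM UNIV (\<lambda>_. fell_borel)) (T j) field_space (C j) \<and>
        colored_process (M j) (T j) (C j) (I j)) \<and>
     random_field MR Rlim \<and> (\<forall>\<omega>\<in>space MR. \<forall>p. Rlim \<omega> p \<in> {0, 1}) \<and>
     fdd_converges M (\<lambda>j \<omega>. partition2 (T j \<omega>)) MR Rlim \<and>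
     random_field MC Clim \<and>
     fdd_converges M C MC Clim"

end

theory Submission
  imports Defs
begin

text \<open>Fix a finite set \<open>J\<close> of points and bounded continuous functions \<open>h x\<close> for \<open>x \<in> J\<close>.  Given the
  tessellation, the points of \<open>J\<close> split into those on the boundary, with color \<open>0\<close>, and classes of points
  in a common cell; different classes are colored by independent copies of the field.  Hence the mean of
  \<open>\<Prod>x\<in>J. h x (I x)\<close> is a finite sum over the relations \<open>Q \<subseteq> J \<times> J\<close> of the probability that
  \<open>Q\<close> is the pattern of common cells on \<open>J\<close>, times a product over the classes \<open>B\<close> of \<open>Q\<close> of the means of
  \<open>\<Prod>x\<in>B. h x (C x)\<close>, times constants \<open>h x 0\<close> (\<open>integral_colored_process\<close>).  The pattern is a
  function of the second order partition process on \<open>J \<times> J\<close>, so each of the finitely many quantities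
  in the sum converges by the hypotheses, and the limit is the same expression in \<open>Rlim\<close> and \<open>Clim\<close>
  (\<open>colored_process_product_limit\<close>).

  What turns this computation into a proof is that products \<open>\<Prod>x\<in>J. h x (z x)\<close> suffice to identify
  laws on \<open>J \<rightarrow> \<real>\<close> (\<open>measure_eqI_products\<close>) and to test weak convergence
  (\<open>weakly_converges_productI\<close>, from the Stone-Weierstrass theorem and a cutoff).  In this way weak
  convergence of products of laws never has to be discussed: a product of means converges because its
  factors do.  The dependence of the limit on the finite-dimensional distributions of \<open>Rlim\<close> and \<open>Clim\<close>
  alone is then immediate (\<open>colored_process_limit_unique\<close>).

  For existence, the limiting functionals have to be those of probability measures.  On a finite set
  \<open>J\<close> one colors the classes of the pattern given by \<open>Rlim\<close> with independent copies of \<open>Clim\<close>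
  (\<open>coloring_of_random_pattern\<close>); a relation that is not a pattern has probability \<open>0\<close> along the
  sequence, hence also in the limit.  A choice of labels that is measurable and works for all points of
  the plane at once is not to be expected, so the finite-dimensional laws are glued by Kolmogorov's extension
  theorem; their consistency follows from being limits of consistent functionals
  (\<open>fdd_limit_exists\<close>).\<close>

section \<open>Products of bounded continuous functions of finitely many coordinates\<close>

lemma bcontfun_measurable:
  fixes g :: "real \<Rightarrow> real"
  assumes "g \<in> bcontfun" shows "g \<in> borel_measurable borel"
  using assms by (auto simp: bcontfun_def intro: borel_measurable_continuous_onI)

lemma bcontfun_mult:
  fixes f g :: "real \<Rightarrow> real"
  assumes "f \<in> bcontfun" "g \<in> bcontfun"
  shows "(\<lambda>t. f t * g t) \<in> bcontfun"
proof -
  obtain B C where "\<forall>t. \<bar>f t\<bar> \<le> B" "\<forall>t. \<bar>g t\<bar> \<le> C"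
    using assms by (auto simp: bcontfun_def bounded_iff)
  then have "\<bar>f t * g t\<bar> \<le> B * C" for t
    unfolding abs_mult by (intro mult_mono) (auto intro: order_trans[OF abs_ge_zero])
  then have "bounded (range (\<lambda>t. f t * g t))" by (auto simp: bounded_iff)
  then show ?thesis
    using assms by (auto simp: bcontfun_def intro!: continuous_intros)
qed

lemma bcontfun_const: "(\<lambda>_. c :: real) \<in> bcontfun"
  by (auto simp: bcontfun_def)

lemma bcontfun_abs_bound:
  fixes g :: "real \<Rightarrow> real"
  assumes "g \<in> bcontfun" obtains B where "\<And>t. \<bar>g t\<bar> \<le> B"
proof -
  from assms obtain B where "\<forall>y\<in>range g. norm y \<le> B"
    unfolding bcontfun_def bounded_iff by auto
  with that[of B] show thesis by auto
qed

text \<open>The bound is uniform in all functions \<open>z\<close>, not only in those that are extensional on \<open>J\<close>,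
  so that it can be used for the law on any index set that contains \<open>J\<close>.\<close>

lemma product_test_bound:
  fixes h :: "'i \<Rightarrow> real \<Rightarrow> real"
  assumes "\<And>x. h x \<in> bcontfun"
  obtains B where "\<And>z. \<bar>\<Prod>x\<in>J. h x (z x)\<bar> \<le> B"
proof -
  have "\<forall>x. \<exists>B. \<forall>t. \<bar>h x t\<bar> \<le> B"
    using bcontfun_abs_bound[OF assms] by metis
  then obtain B where B: "\<And>x t. \<bar>h x t\<bar> \<le> B x" by metis
  have "\<bar>\<Prod>x\<in>J. h x (z x)\<bar> \<le> (\<Prod>x\<in>J. B x)" for z
    unfolding abs_prod by (rule prod_mono) (use B in auto)
  then show thesis by (rule that)
qed

lemma product_test_measurable:
  fixes h :: "'i \<Rightarrow> real \<Rightarrow> real"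
  assumes "\<And>x. h x \<in> bcontfun" "H \<subseteq> J"
  shows "(\<lambda>z. \<Prod>x\<in>H. h x (z x)) \<in> borel_measurable (PiM J (\<lambda>_. borel))"
proof (rule borel_measurable_prod)
  fix x assume "x \<in> H"
  then have "x \<in> J" using assms by auto
  then have "(\<lambda>z. z x) \<in> PiM J (\<lambda>_. borel) \<rightarrow>\<^sub>M (borel :: real measure)"
    by (rule measurable_component_singleton)
  from measurable_compose[OF this bcontfun_measurable[OF assms(1)]]
  show "(\<lambda>z. h x (z x)) \<in> borel_measurable (PiM J (\<lambda>_. borel))" .
qed

lemma product_test_continuous_map:
  fixes h :: "'i \<Rightarrow> real \<Rightarrow> real"
  assumes "finite J" "\<And>x. h x \<in> bcontfun"
  shows "continuous_map (product_topology (\<lambda>_. euclideanreal) J) euclideanreal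
    (\<lambda>z. \<Prod>x\<in>J. h x (z x))"
proof (rule continuous_map_prod[OF assms(1)])
  fix x assume "x \<in> J"
  then have "continuous_map (product_topology (\<lambda>_. euclideanreal) J) euclideanreal (\<lambda>z. z x)"
    by (rule continuous_map_product_projection)
  moreover have "continuous_map euclideanreal euclideanreal (h x)"
    using assms(2)[of x] by (auto simp: bcontfun_def)
  ultimately show "continuous_map (product_topology (\<lambda>_. euclideanreal) J) euclideanreal
      (\<lambda>z. h x (z x))"
    using continuous_map_compose[of _ _ "\<lambda>z. z x" _ "h x"] by (simp add: comp_def)
qed

lemma weakly_converges_productD:
  fixes h :: "'i \<Rightarrow> real \<Rightarrow> real"
  assumes "weakly_converges (product_topology (\<lambda>_. euclideanreal) J) \<mu> \<nu>"
    and "finite J" "\<And>x. h x \<in> bcontfun"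
  shows "(\<lambda>j. \<integral>z. (\<Prod>x\<in>J. h x (z x)) \<partial>\<mu> j) \<longlonglongrightarrow> (\<integral>z. (\<Prod>x\<in>J. h x (z x)) \<partial>\<nu>)"
proof -
  obtain B where "\<And>z. \<bar>\<Prod>x\<in>J. h x (z x)\<bar> \<le> B"
    by (rule product_test_bound[where J = J and h = h]) (rule assms(3), blast)
  then have "bounded ((\<lambda>z. \<Prod>x\<in>J. h x (z x)) ` topspace (product_topology (\<lambda>_. euclideanreal) J))"
    by (auto simp: bounded_iff)
  with product_test_continuous_map[OF assms(2,3)] show ?thesis
    by (intro assms(1)[unfolded weakly_converges_def, rule_format] conjI)
qed

section \<open>Products determine laws and weak convergence\<close>

text \<open>Open boxes form a generator that is stable under intersection, and the indicator of a
  box is a limit of products of bounded continuous functions.  This is why products determine a law.\<close>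

lemma sets_PiM_borel_open_boxes:
  "sets (PiM J (\<lambda>_. borel :: real measure)) =
     sigma_sets (PiE J (\<lambda>_. UNIV)) {PiE J U | U. \<forall>x. open (U x)}"
  if "finite J"
proof (rule antisym)
  let ?N = "sigma (PiE J (\<lambda>_. UNIV :: real set)) {PiE J U | U. \<forall>x. open (U x)}"
  have sub: "{PiE J U | U. \<forall>x. open (U x)} \<subseteq> Pow (PiE J (\<lambda>_. UNIV :: real set))"
    by auto
  have setsN: "sets ?N = sigma_sets (PiE J (\<lambda>_. UNIV)) {PiE J U | U. \<forall>x. open (U x)}"
    using sub by simp
  have spN: "space ?N = PiE J (\<lambda>_. UNIV)" using sub by simp
  have "sets (PiM J (\<lambda>_. borel :: real measure)) \<subseteq> sets ?N"
  proof (rule sets_PiM_in_sets)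
    show "space ?N = (\<Pi>\<^sub>E i\<in>J. space borel)" using spN by simp
    fix i and A :: "real set" assume i: "i \<in> J" and A: "A \<in> sets borel"
    have "(\<lambda>x. x i) \<in> borel_measurable ?N"
    proof (rule borel_measurableI)
      fix S :: "real set" assume "open S"
      have "(\<lambda>x. x i) -` S \<inter> space ?N = PiE J (\<lambda>k. if k = i then S else UNIV)"
        unfolding spN using i by (auto simp: PiE_iff split: if_splits)
      also have "\<dots> \<in> sets ?N"
        unfolding setsN using \<open>open S\<close> by (intro sigma_sets.Basic) auto
      finally show "(\<lambda>x. x i) -` S \<inter> space ?N \<in> sets ?N" .
    qed
    from measurable_sets[OF this A]
    show "{x \<in> space ?N. x i \<in> A} \<in> sets ?N"
      by (simp add: vimage_def Int_def conj_commute)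
  qed
  then show "sets (PiM J (\<lambda>_. borel :: real measure)) \<subseteq>
     sigma_sets (PiE J (\<lambda>_. UNIV)) {PiE J U | U. \<forall>x. open (U x)}"
    using setsN by simp
next
  have "{PiE J U | U :: _ \<Rightarrow> real set. \<forall>x. open (U x)} \<subseteq> sets (PiM J (\<lambda>_. borel))"
    using that by (auto intro!: sets_PiM_I_finite)
  then have "sigma_sets (space (PiM J (\<lambda>_. borel))) {PiE J U | U :: _ \<Rightarrow> real set. \<forall>x. open (U x)}
      \<subseteq> sets (PiM J (\<lambda>_. borel))"
    by (rule sets.sigma_sets_subset)
  then show "sigma_sets (PiE J (\<lambda>_. UNIV)) {PiE J U | U. \<forall>x. open (U x)} \<subseteq>
      sets (PiM J (\<lambda>_. borel :: real measure))"
    by (simp add: space_PiM)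
qed

text \<open>The functions \<open>min 1 (n * infdist t (- U))\<close> increase to the indicator of \<open>U\<close>.  The case
  \<open>U = UNIV\<close> is separate because the distance to the empty set is \<open>0\<close> by convention.\<close>

lemma open_indicator_approximation:
  assumes "open (U :: real set)"
  obtains h where "\<And>n. h n \<in> bcontfun" "\<And>n t. h n t \<in> {0..1}"
    "\<And>t. (\<lambda>n. h n t :: real) \<longlonglongrightarrow> indicator U t"
proof (cases "U = UNIV")
  case True
  show thesis
    by (rule that[of "\<lambda>_ _. 1"]) (auto simp: True bcontfun_const)
next
  case False
  define h where "h n t = min 1 (real n * infdist t (- U))" for n :: nat and t
  have range: "h n t \<in> {0..1}" for n t
    by (auto simp: h_def infdist_nonneg)
  show thesis
  proof (rule that[of h])
    fix n
    have "bounded (range (h n))"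
      by (rule bounded_subset[of "{0..1}"]) (use range in auto)
    then show "h n \<in> bcontfun"
      unfolding bcontfun_def h_def by (auto intro!: continuous_intros)
  next
    fix t
    show "(\<lambda>n. h n t) \<longlonglongrightarrow> indicator U t"
    proof (cases "t \<in> U")
      case True
      have "infdist t (- U) > 0"
        using True False assms
        by (metis ComplD closed_Compl in_closed_iff_infdist_zero infdist_nonneg less_eq_real_def
            Compl_eq_Diff_UNIV Diff_eq_empty_iff top.extremum_uniqueI)
      then have "filterlim (\<lambda>n. real n * infdist t (- U)) at_top sequentially"
        by (intro filterlim_at_top_mult_tendsto_pos[OF tendsto_const _ filterlim_real_sequentially, 
              where c = "infdist t (- U)", simplified mult.commute])
      then have "eventually (\<lambda>n. 1 \<le> real n * infdist t (- U)) sequentially"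
        by (simp add: filterlim_at_top)
      then have "eventually (\<lambda>n. h n t = indicator U t) sequentially"
        by eventually_elim (use True in \<open>auto simp: h_def\<close>)
      then show ?thesis by (rule tendsto_eventually)
    next
      case f: False
      then have "h n t = 0" for n by (simp add: h_def)
      then show ?thesis using f by simp
    qed
  qed (use range in auto)
qed

text \<open>Dominated convergence passes from products of bounded continuous functions to indicators of
  open boxes, and these determine a probability measure.\<close>

lemma measure_eqI_products:
  fixes \<mu> \<nu> :: "('i \<Rightarrow> real) measure"
  assumes J: "finite J"
    and \<mu>: "prob_space \<mu>" "sets \<mu> = sets (PiM J (\<lambda>_. borel))"
    and \<nu>: "prob_space \<nu>" "sets \<nu> = sets (PiM J (\<lambda>_. borel))"
    and eq: "\<And>h :: 'i \<Rightarrow> real \<Rightarrow> real. (\<And>x. h x \<in> bcontfun) \<Longrightarrow>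
      (\<integral>z. (\<Prod>x\<in>J. h x (z x)) \<partial>\<mu>) = (\<integral>z. (\<Prod>x\<in>J. h x (z x)) \<partial>\<nu>)"
  shows "\<mu> = \<nu>"
proof -
  let ?E = "{PiE J U | U :: 'i \<Rightarrow> real set. \<forall>x. open (U x)}"
  have box: "emeasure \<mu> (PiE J U) = emeasure \<nu> (PiE J U)" if U: "\<forall>x. open (U x)" for U
  proof -
    have "\<forall>x. \<exists>h :: nat \<Rightarrow> real \<Rightarrow> real. (\<forall>n. h n \<in> bcontfun) \<and> (\<forall>n t. h n t \<in> {0..1}) \<and>
        (\<forall>t. (\<lambda>n. h n t) \<longlonglongrightarrow> indicator (U x) t)"
      using open_indicator_approximation U by metis
    then obtain h :: "'i \<Rightarrow> nat \<Rightarrow> real \<Rightarrow> real" where h: "\<And>x n. h x n \<in> bcontfun"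
      "\<And>x n t. h x n t \<in> {0..1}" "\<And>x t. (\<lambda>n. h x n t) \<longlonglongrightarrow> indicator (U x) t"
      by metis
    have lim: "(\<lambda>n. \<integral>z. (\<Prod>x\<in>J. h x n (z x)) \<partial>\<rho>) \<longlonglongrightarrow> measure \<rho> (PiE J U)"
      if \<rho>: "prob_space \<rho>" "sets \<rho> = sets (PiM J (\<lambda>_. borel))" for \<rho>
    proof -
      interpret prob_space \<rho> by fact
      have sp: "space \<rho> = PiE J (\<lambda>_. UNIV)"
        using sets_eq_imp_space_eq[OF \<rho>(2)] by (simp add: space_PiM)
      have mU: "PiE J U \<in> sets \<rho>"
        unfolding \<rho>(2) using J U by (auto intro!: sets_PiM_I_finite)
      have "(\<lambda>n. \<integral>z. (\<Prod>x\<in>J. h x n (z x)) \<partial>\<rho>) \<longlonglongrightarrow> (\<integral>z. indicator (PiE J U) z \<partial>\<rho>)"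
      proof (rule integral_dominated_convergence[where w = "\<lambda>_. 1"])
        show "(\<lambda>z. \<Prod>x\<in>J. h x n (z x)) \<in> borel_measurable \<rho>" for n
          unfolding measurable_cong_sets[OF \<rho>(2) refl]
          by (rule product_test_measurable) (use h in auto)
        show "AE z in \<rho>. norm (\<Prod>x\<in>J. h x n (z x)) \<le> 1" for n
        proof (rule AE_I2)
          fix z
          have "(\<Prod>x\<in>J. \<bar>h x n (z x)\<bar>) \<le> 1" by (rule prod_le_1) (use h(2) in auto)
          then show "norm (\<Prod>x\<in>J. h x n (z x)) \<le> 1" by (simp add: abs_prod)
        qed
        show "AE z in \<rho>. (\<lambda>n. \<Prod>x\<in>J. h x n (z x)) \<longlonglongrightarrow> indicator (PiE J U) z"
        proof (rule AE_I2)
          fix z assume "z \<in> space \<rho>"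
          then have "(\<Prod>x\<in>J. indicator (U x) (z x) :: real) = indicator (PiE J U) z"
            unfolding sp using J by (auto simp: indicator_def PiE_iff)
          moreover have "(\<lambda>n. \<Prod>x\<in>J. h x n (z x)) \<longlonglongrightarrow> (\<Prod>x\<in>J. indicator (U x) (z x))"
            by (intro tendsto_prod h)
          ultimately show "(\<lambda>n. \<Prod>x\<in>J. h x n (z x)) \<longlonglongrightarrow> indicator (PiE J U) z" by simp
        qed
      qed (use mU in auto)
      also have "(\<integral>z. indicator (PiE J U) z \<partial>\<rho>) = measure \<rho> (PiE J U)"
        using mU sets.sets_into_space[OF mU] by (simp add: Int_absorb2)
      finally show ?thesis .
    qed
    have "measure \<mu> (PiE J U) = measure \<nu> (PiE J U)"
    proof (rule LIMSEQ_unique[OF lim[OF \<mu>]])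
      have "(\<integral>z. (\<Prod>x\<in>J. h x n (z x)) \<partial>\<mu>) = (\<integral>z. (\<Prod>x\<in>J. h x n (z x)) \<partial>\<nu>)" for n
        by (rule eq) (rule h(1))
      with lim[OF \<nu>]
      show "(\<lambda>n. \<integral>z. (\<Prod>x\<in>J. h x n (z x)) \<partial>\<mu>) \<longlonglongrightarrow> measure \<nu> (PiE J U)" by simp
    qed
    then show ?thesis
      using \<mu>(1) \<nu>(1) by (simp add: prob_space_def finite_measure.emeasure_eq_measure)
  qed
  show ?thesis
  proof (rule measure_eqI_generator_eq[where E = ?E and \<Omega> = "PiE J (\<lambda>_. UNIV)"
        and A = "\<lambda>_. PiE J (\<lambda>_. UNIV)"])
    show "Int_stable ?E"
    proof (rule Int_stableI)
      fix a b assume "a \<in> ?E" "b \<in> ?E"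
      then obtain U V where "a = PiE J U" "b = PiE J V" "\<forall>x. open (U x)" "\<forall>x. open (V x)"
        by auto
      then have "a \<inter> b = PiE J (\<lambda>x. U x \<inter> V x)" "\<forall>x. open (U x \<inter> V x)"
        by (auto simp: PiE_Int)
      then show "a \<inter> b \<in> ?E" by auto
    qed
    show "sets \<mu> = sigma_sets (PiE J (\<lambda>_. UNIV)) ?E" "sets \<nu> = sigma_sets (PiE J (\<lambda>_. UNIV)) ?E"
      using sets_PiM_borel_open_boxes[OF J] \<mu>(2) \<nu>(2) by simp_all
    show "range (\<lambda>_. PiE J (\<lambda>_. UNIV)) \<subseteq> ?E" by auto
    show "emeasure \<mu> (PiE J (\<lambda>_. UNIV)) \<noteq> \<infinity>"
      using \<mu>(1) by (simp add: prob_space_def finite_measure.emeasure_eq_measure)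
  qed (use box in auto)
qed

text \<open>The algebra generated by the products.  Its members depend only on the coordinates in \<open>J\<close>,
  are bounded, and inherit by linearity every convergence that holds for products; it is the algebra
  to which the Stone-Weierstrass theorem is applied.\<close>

inductive_set product_algebra :: "'i set \<Rightarrow> (('i \<Rightarrow> real) \<Rightarrow> real) set" for J where
  product: "(\<And>x. h x \<in> bcontfun) \<Longrightarrow> (\<lambda>z. c * (\<Prod>x\<in>J. h x (z x))) \<in> product_algebra J"
| sum: "f \<in> product_algebra J \<Longrightarrow> g \<in> product_algebra J \<Longrightarrow> (\<lambda>z. f z + g z) \<in> product_algebra J"

lemma product_algebra_mult:
  assumes "f \<in> product_algebra J" "g \<in> product_algebra J"
  shows "(\<lambda>z. f z * g z) \<in> product_algebra J"
  using assms
proof (induction)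
  case f: (product h c)
  from f(2) show ?case
  proof (induction)
    case g: (product k d)
    have "(\<lambda>z. (c * d) * (\<Prod>x\<in>J. h x (z x) * k x (z x))) \<in> product_algebra J"
      using f(1) g by (intro product_algebra.product bcontfun_mult)
    then show ?case by (simp add: prod.distrib mult_ac)
  next
    case (sum g k)
    from product_algebra.sum[OF sum.IH] show ?case by (simp add: distrib_left)
  qed
next
  case (sum f k)
  from product_algebra.sum[OF sum.IH[OF sum.prems]] show ?case by (simp add: distrib_right)
qed

lemma product_algebra_const: "(\<lambda>_. c) \<in> product_algebra J"
  using product_algebra.product[of "\<lambda>_ _. 1" c J] by (simp add: bcontfun_const)

lemma product_algebra_continuous:
  assumes "f \<in> product_algebra J" shows "continuous_on S f"
  using assms
proof (induction)
  case (product h c)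
  have "continuous_on UNIV (h x)" for x
    using product[of x] by (simp add: bcontfun_def)
  then have "continuous_on S (\<lambda>z. h x (z x))" for x
    by (rule continuous_on_compose2[where g = "h x"])
       (auto intro: continuous_on_subset[OF continuous_on_product_coordinates])
  then show ?case by (intro continuous_intros)
next
  case (sum f g)
  from continuous_on_add[OF sum.IH] show ?case .
qed

lemma product_algebra_cong:
  assumes "f \<in> product_algebra J" "\<And>x. x \<in> J \<Longrightarrow> z x = w x"
  shows "f z = f w"
  using assms by (induction) (auto intro!: prod.cong)

lemma product_algebra_measurable:
  assumes "f \<in> product_algebra J" shows "f \<in> borel_measurable (PiM J (\<lambda>_. borel))"
  using assms
proof (induction)
  case (product h c)
  show ?case
    by (intro borel_measurable_times borel_measurable_const product_test_measurable product subset_refl)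
next
  case (sum f g)
  from borel_measurable_add[OF sum.IH] show ?case .
qed

lemma product_algebra_bounded:
  assumes "f \<in> product_algebra J" shows "\<exists>B. \<forall>z. \<bar>f z\<bar> \<le> B"
  using assms
proof (induction)
  case (product h c)
  obtain B where B: "\<And>z. \<bar>\<Prod>x\<in>J. h x (z x)\<bar> \<le> B"
    by (rule product_test_bound[where J = J and h = h]) (rule product, blast)
  then have "\<bar>c * (\<Prod>x\<in>J. h x (z x))\<bar> \<le> \<bar>c\<bar> * B" for z
    unfolding abs_mult by (intro mult_left_mono) auto
  then show ?case by (intro exI allI)
next
  case (sum f g)
  from sum.IH obtain B C where B: "\<forall>z. \<bar>f z\<bar> \<le> B" and C: "\<forall>z. \<bar>g z\<bar> \<le> C" by (elim exE)
  have "\<bar>f z + g z\<bar> \<le> B + C" for z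
    using B[rule_format, of z] C[rule_format, of z] by linarith
  then show ?case by (intro exI allI)
qed

lemma product_algebra_integrable:
  assumes "f \<in> product_algebra J" "prob_space \<mu>" "sets \<mu> = sets (PiM J (\<lambda>_. borel))"
  shows "integrable \<mu> f"
proof -
  interpret prob_space \<mu> by fact
  obtain B where "\<forall>z. \<bar>f z\<bar> \<le> B" using product_algebra_bounded[OF assms(1)] by auto
  then show ?thesis
    using product_algebra_measurable[OF assms(1)] measurable_cong_sets[OF assms(3) refl]
    by (intro integrable_const_bound[of _ B]) auto
qed

text \<open>Stone-Weierstrass on the box of functions with values in \<open>[-a, a]\<close> on \<open>J\<close> and value \<open>0\<close>
  elsewhere, which is compact in the space of all functions.  Points of this box that differ do so at
  some coordinate in \<open>J\<close>, and the bounded injective function \<open>arctan\<close> of that coordinate separates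
  them.\<close>

lemma product_algebra_dense_countable:
  fixes J :: "'i :: countable set"
  assumes J: "finite J"
    and f: "continuous_map (product_topology (\<lambda>_. euclideanreal) J) euclideanreal f"
    and e: "e > 0"
  obtains g where "g \<in> product_algebra J"
    "\<And>z. z \<in> PiE J (\<lambda>_. {-a..a}) \<Longrightarrow> \<bar>f z - g z\<bar> < e"
proof -
  let ?S = "PiE UNIV (\<lambda>x. if x \<in> J then {-a..a} else {0 :: real})"
  interpret function_ring_on "product_algebra J" ?S
  proof
    have "compactin (product_topology (\<lambda>_. euclideanreal) UNIV) ?S"
      unfolding compactin_PiE by (intro disjI2 ballI) (simp add: compactin_euclidean_iff)
    then show "compact ?S" by (simp add: euclidean_product_topology)
  next
    fix z w :: "_ \<Rightarrow> real" assume zw: "z \<in> ?S" "w \<in> ?S" "z \<noteq> w"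
    from zw(3) obtain i where i: "z i \<noteq> w i" unfolding fun_eq_iff by blast
    have iJ: "i \<in> J"
    proof (rule ccontr)
      assume "i \<notin> J"
      then have "z i = 0" "w i = 0" using zw(1,2) by (auto simp: PiE_iff dest!: spec[of _ i] split: if_splits)
      with i show False by simp
    qed
    let ?h = "\<lambda>x. if x = i then arctan else (\<lambda>_. 1)"
    have "\<bar>arctan t\<bar> \<le> pi / 2" for t
      using arctan_bounded[of t] by linarith
    then have "bounded (range arctan)" unfolding bounded_iff by (intro exI[of _ "pi / 2"]) simp
    then have "arctan \<in> bcontfun"
      unfolding bcontfun_def by (auto intro!: continuous_intros)
    then have "(\<lambda>z. 1 * (\<Prod>x\<in>J. ?h x (z x))) \<in> product_algebra J"
      by (intro product_algebra.product) (auto simp: bcontfun_const)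
    moreover have "(\<Prod>x\<in>J. ?h x (v x)) = arctan (v i)" for v
      using J iJ by (subst prod.remove[of _ i]) auto
    ultimately have "(\<lambda>z. arctan (z i)) \<in> product_algebra J" by simp
    then show "\<exists>f\<in>product_algebra J. f z \<noteq> f w"
      by (rule rev_bexI) (simp add: i arctan_eq_iff)
  qed (auto intro: product_algebra_continuous product_algebra.sum product_algebra_mult
        product_algebra_const)
  have "continuous_map (product_topology (\<lambda>_. euclideanreal) UNIV)
      (product_topology (\<lambda>_. euclideanreal) J) (\<lambda>z. restrict z J)"
    by (subst continuous_map_componentwise)
       (auto intro: continuous_map_product_projection simp: restrict_apply')
  from continuous_map_compose[OF this f]
  have "continuous_on UNIV (f \<circ> (\<lambda>z. restrict z J))"
    by (simp add: euclidean_product_topology)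
  then have "continuous_on ?S (\<lambda>z. f (restrict z J))"
    unfolding comp_def by (rule continuous_on_subset) simp
  from Stone_Weierstrass_basic[OF this e]
  obtain g where g: "g \<in> product_algebra J" "\<And>z. z \<in> ?S \<Longrightarrow> \<bar>f (restrict z J) - g z\<bar> < e"
    by auto
  show thesis
  proof (rule that[OF g(1)])
    fix z :: "'i \<Rightarrow> real" assume z: "z \<in> PiE J (\<lambda>_. {-a..a})"
    (* Outside J the functions of an extensional product are undefined; zero is the
       value that the compact set used above prescribes there. *)
    let ?z = "\<lambda>x. if x \<in> J then z x else 0"
    have "restrict ?z J = z" using z by (auto simp: fun_eq_iff PiE_iff extensional_def)
    moreover have "?z \<in> ?S" using z by (auto simp: PiE_iff)
    moreover have "g ?z = g z" by (rule product_algebra_cong[OF g(1)]) simp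
    ultimately show "\<bar>f z - g z\<bar> < e" using g(2)[of ?z] by simp
  qed
qed

text \<open>Only the cardinality of a finite index set matters.  This transports the approximation from
  finite sets of natural numbers, where the surrounding function space is metrizable, to finite
  subsets of an uncountable index set such as the plane.\<close>

lemma product_algebra_reindex:
  assumes "g \<in> product_algebra K" and d: "bij_betw d K J"
  shows "(\<lambda>z. g (\<lambda>k. z (d k))) \<in> product_algebra J"
  using assms(1)
proof (induction)
  case (product h c)
  have "(\<Prod>x\<in>J. h (inv_into K d x) (z x)) = (\<Prod>k\<in>K. h k (z (d k)))" for z
    using d by (subst prod.reindex_bij_betw[OF d, symmetric])
      (auto intro!: prod.cong simp: bij_betw_def inv_into_f_f)
  moreover have "(\<lambda>z. c * (\<Prod>x\<in>J. h (inv_into K d x) (z x))) \<in> product_algebra J"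
    by (rule product_algebra.product) (rule product)
  ultimately show ?case by simp
next
  case (sum f g)
  from product_algebra.sum[OF sum.IH] show ?case .
qed

lemma product_algebra_dense:
  fixes J :: "'i set"
  assumes J: "finite J"
    and f: "continuous_map (product_topology (\<lambda>_. euclideanreal) J) euclideanreal f"
    and e: "e > 0"
  obtains g where "g \<in> product_algebra J"
    "\<And>z. z \<in> PiE J (\<lambda>_. {-a..a}) \<Longrightarrow> \<bar>f z - g z\<bar> < e"
proof -
  obtain c :: "'i \<Rightarrow> nat" where c: "inj_on c J"
    using finite_imp_inj_to_nat_seg[OF J] by auto
  define d where "d = inv_into J c"
  have d: "bij_betw d (c ` J) J"
    unfolding d_def using c by (intro bij_betw_inv_into) (auto simp: bij_betw_def)
  have dc: "d (c x) = x" if "x \<in> J" for x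
    using that c by (simp add: d_def)
  have "continuous_map (product_topology (\<lambda>_. euclideanreal) (c ` J))
      (product_topology (\<lambda>_. euclideanreal) J) (\<lambda>w. \<lambda>x\<in>J. w (c x))"
    by (subst continuous_map_componentwise)
       (auto intro: continuous_map_product_projection simp: restrict_apply')
  then have "continuous_map (product_topology (\<lambda>_. euclideanreal) (c ` J)) euclideanreal
      (f \<circ> (\<lambda>w. \<lambda>x\<in>J. w (c x)))"
    using f by (rule continuous_map_compose)
  then obtain g where g: "g \<in> product_algebra (c ` J)"
    "\<And>w. w \<in> PiE (c ` J) (\<lambda>_. {-a..a}) \<Longrightarrow> \<bar>(f \<circ> (\<lambda>w. \<lambda>x\<in>J. w (c x))) w - g w\<bar> < e"
    using product_algebra_dense_countable[OF finite_imageI[OF J] _ e] by blast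
  show thesis
  proof (rule that[OF product_algebra_reindex[OF g(1) d]])
    fix z :: "'i \<Rightarrow> real" assume z: "z \<in> PiE J (\<lambda>_. {-a..a})"
    let ?w = "\<lambda>k\<in>c ` J. z (d k)"
    have "?w \<in> PiE (c ` J) (\<lambda>_. {-a..a})" using z dc by (auto simp: PiE_iff)
    moreover have "(\<lambda>x\<in>J. ?w (c x)) = z"
      using z dc by (auto simp: fun_eq_iff PiE_iff extensional_def)
    moreover have "g ?w = g (\<lambda>k. z (d k))" by (rule product_algebra_cong[OF g(1)]) simp
    ultimately show "\<bar>f z - g (\<lambda>k. z (d k))\<bar> < e" using g(2)[of ?w] by simp
  qed
qed

text \<open>For finite \<open>J\<close> a continuous function is the pointwise limit of
  members of the product algebra, taken on boxes that exhaust the space, and those are measurable.\<close>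

lemma continuous_map_product_measurable:
  assumes J: "finite J"
    and f: "continuous_map (product_topology (\<lambda>_. euclideanreal) J) euclideanreal f"
  shows "f \<in> borel_measurable (PiM J (\<lambda>_. borel))"
proof -
  have "\<exists>g. g \<in> product_algebra J \<and>
      (\<forall>z. z \<in> PiE J (\<lambda>_. {-real n..real n}) \<longrightarrow> \<bar>f z - g z\<bar> < 1 / real (Suc n))" for n
    by (rule product_algebra_dense[OF J f, of "1 / real (Suc n)" "real n"]) auto
  then obtain g where g: "\<And>n. g n \<in> product_algebra J"
    "\<And>n z. z \<in> PiE J (\<lambda>_. {-real n..real n}) \<Longrightarrow> \<bar>f z - g n z\<bar> < 1 / real (Suc n)"
    by metis
  show ?thesis
  proof (rule borel_measurable_LIMSEQ_real)
    show "g n \<in> borel_measurable (PiM J (\<lambda>_. borel))" for n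
      by (rule product_algebra_measurable[OF g(1)])
    fix z :: "'a \<Rightarrow> real" assume "z \<in> space (PiM J (\<lambda>_. borel))"
    then have z: "z \<in> PiE J (\<lambda>_. UNIV)" by (simp add: space_PiM)
    obtain m where m: "(\<Sum>x\<in>J. \<bar>z x\<bar>) \<le> real m" using real_arch_simple by blast
    have "eventually (\<lambda>n. norm (g n z - f z) \<le> 1 / real (Suc n)) sequentially"
      using eventually_ge_at_top[of m]
    proof eventually_elim
      case (elim n)
      have "\<bar>z x\<bar> \<le> real n" if "x \<in> J" for x
        using member_le_sum[of x J "\<lambda>x. \<bar>z x\<bar>"] J that m elim by simp
      then have "- real n \<le> z x \<and> z x \<le> real n" if "x \<in> J" for x
        using that by (simp add: abs_le_iff minus_le_iff)
      then have "z \<in> PiE J (\<lambda>_. {-real n..real n})" using z by (simp add: PiE_iff)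
      from g(2)[OF this] show ?case by (simp add: abs_minus_commute)
    qed
    then have "(\<lambda>n. g n z - f z) \<longlonglongrightarrow> 0"
      by (rule Lim_null_comparison) (rule LIMSEQ_Suc[OF lim_1_over_n])
    then show "(\<lambda>n. g n z) \<longlonglongrightarrow> f z" by (simp add: LIM_zero_iff)
  qed
qed

text \<open>Tightness of a single law, in a form that can be tested: a cutoff that is itself a product of
  bounded continuous functions.  Weak convergence then transfers the tail bound to the sequence.\<close>

lemma product_cutoff:
  fixes \<nu> :: "('i \<Rightarrow> real) measure" and e :: real
  assumes J: "finite J" and \<nu>: "prob_space \<nu>" "sets \<nu> = sets (PiM J (\<lambda>_. borel))" and e: "e > 0"
  obtains h a where "h \<in> bcontfun" "\<And>t. 0 \<le> h t" "\<And>t. h t \<le> 1"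
    "\<And>t. h t \<noteq> 0 \<Longrightarrow> t \<in> {-a..a}" "(\<integral>z. (\<Prod>x\<in>J. h (z x)) \<partial>\<nu>) > 1 - e"
proof -
  interpret prob_space \<nu> by fact
  define h where "h n t = max 0 (min 1 (real n + 1 - \<bar>t\<bar>))" for n t
  have range: "0 \<le> h n t" "h n t \<le> 1" for n t by (auto simp: h_def)
  have bc: "h n \<in> bcontfun" for n
  proof -
    have "bounded (range (h n))"
      by (rule bounded_subset[of "{0..1}"]) (use range in auto)
    then show ?thesis unfolding bcontfun_def h_def by (auto intro!: continuous_intros)
  qed
  have "(\<lambda>n. \<integral>z. (\<Prod>x\<in>J. h n (z x)) \<partial>\<nu>) \<longlonglongrightarrow> (\<integral>z. 1 \<partial>\<nu>)"
  proof (rule integral_dominated_convergence[where w = "\<lambda>_. 1"])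
    show "(\<lambda>z. \<Prod>x\<in>J. h n (z x)) \<in> borel_measurable \<nu>" for n
      unfolding measurable_cong_sets[OF \<nu>(2) refl]
      by (rule product_test_measurable) (use bc in auto)
    show "AE z in \<nu>. norm (\<Prod>x\<in>J. h n (z x)) \<le> 1" for n
      unfolding real_norm_def abs_prod by (rule AE_I2, rule prod_le_1) (simp add: range)
    show "AE z in \<nu>. (\<lambda>n. \<Prod>x\<in>J. h n (z x)) \<longlonglongrightarrow> 1"
    proof (rule AE_I2)
      fix z
      have "(\<lambda>n. h n t) \<longlonglongrightarrow> 1" for t
      proof (rule tendsto_eventually)
        obtain m where m: "\<bar>t\<bar> \<le> real m" using real_arch_simple by blast
        show "eventually (\<lambda>n. h n t = 1) sequentially"
          using eventually_ge_at_top[of m]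
        proof eventually_elim
          case (elim n)
          then have "\<bar>t\<bar> \<le> real n" using m by linarith
          then show ?case by (simp add: h_def)
        qed
      qed
      then have "(\<lambda>n. \<Prod>x\<in>J. h n (z x)) \<longlonglongrightarrow> (\<Prod>x\<in>J. 1)" by (rule tendsto_prod)
      then show "(\<lambda>n. \<Prod>x\<in>J. h n (z x)) \<longlonglongrightarrow> 1" by simp
    qed
  qed auto
  then have "eventually (\<lambda>n. (\<integral>z. (\<Prod>x\<in>J. h n (z x)) \<partial>\<nu>) > 1 - e) sequentially"
    using e by (intro order_tendstoD) (auto simp: prob_space)
  then obtain n where n: "(\<integral>z. (\<Prod>x\<in>J. h n (z x)) \<partial>\<nu>) > 1 - e"
    by (auto simp: eventually_sequentially)
  show thesis
  proof (rule that[of "h n" "real n + 1"])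
    show "t \<in> {- (real n + 1)..real n + 1}" if "h n t \<noteq> 0" for t
      using that unfolding h_def by (simp add: abs_le_iff max_def min_def split: if_splits)
  qed (fact bc range n)+
qed

text \<open>Products of bounded continuous functions of the coordinates are convergence determining.
  Given bounded continuous \<open>f\<close>, multiply by a product cutoff \<open>\<phi>\<close> that loses little mass in the limit
  law, hence eventually little mass along the sequence, and replace \<open>f\<close> by a member \<open>g\<close> of the product
  algebra that is uniformly close to \<open>f\<close> on the support of \<open>\<phi>\<close>.  Since \<open>g * \<phi>\<close> is again in the algebra, its
  integrals converge.\<close>

lemma weakly_converges_productI:
  fixes \<mu> :: "nat \<Rightarrow> ('i \<Rightarrow> real) measure"
  assumes J: "finite J"
    and \<mu>: "\<And>j. prob_space (\<mu> j)" "\<And>j. sets (\<mu> j) = sets (PiM J (\<lambda>_. borel))"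
    and \<nu>: "prob_space \<nu>" "sets \<nu> = sets (PiM J (\<lambda>_. borel))"
    and conv: "\<And>h :: 'i \<Rightarrow> real \<Rightarrow> real. (\<And>x. h x \<in> bcontfun) \<Longrightarrow>
      (\<lambda>j. \<integral>z. (\<Prod>x\<in>J. h x (z x)) \<partial>\<mu> j) \<longlonglongrightarrow> (\<integral>z. (\<Prod>x\<in>J. h x (z x)) \<partial>\<nu>)"
  shows "weakly_converges (product_topology (\<lambda>_. euclideanreal) J) \<mu> \<nu>"
  unfolding weakly_converges_def
proof (intro allI impI, elim conjE)
  fix f assume f: "continuous_map (product_topology (\<lambda>_. euclideanreal) J) euclideanreal f"
    and "bounded (f ` topspace (product_topology (\<lambda>_. euclideanreal) J))"
  then obtain B where "\<And>z. z \<in> PiE J (\<lambda>_. UNIV) \<Longrightarrow> \<bar>f z\<bar> \<le> B"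
    by (auto simp: bounded_iff)
  \<comment> \<open>The bound is made positive because the cutoff below loses mass less than \<open>e\<close> divided by it.\<close>
  then have B: "\<bar>f z\<bar> \<le> max 1 B" if "z \<in> PiE J (\<lambda>_. UNIV)" for z
    using that by (meson max.coboundedI2)
  define B' where "B' = max 1 B"
  have B'_pos: "B' > 0" by (simp add: B'_def)
  have conv': "(\<lambda>j. \<integral>z. g z \<partial>\<mu> j) \<longlonglongrightarrow> (\<integral>z. g z \<partial>\<nu>)" if "g \<in> product_algebra J" for g
    using that
  proof (induction)
    case (product h c)
    then show ?case using tendsto_mult_left[OF conv[OF product]] by simp
  next
    case (sum g k)
    have "(\<integral>z. g z + k z \<partial>\<rho>) = (\<integral>z. g z \<partial>\<rho>) + (\<integral>z. k z \<partial>\<rho>)"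
      if "prob_space \<rho>" "sets \<rho> = sets (PiM J (\<lambda>_. borel))" for \<rho>
      using sum that by (intro Bochner_Integration.integral_add product_algebra_integrable)
    then show ?case using \<mu> \<nu> tendsto_add[OF sum.IH] by simp
  qed
  show "(\<lambda>j. \<integral>z. f z \<partial>\<mu> j) \<longlonglongrightarrow> (\<integral>z. f z \<partial>\<nu>)"
  proof (rule LIMSEQ_I)
    fix r :: real assume "r > 0"
    \<comment> \<open>The sequence and the limit each contribute an approximation error of at most \<open>2 e\<close>,
      and the integrals of \<open>g * \<phi>\<close> differ by less than \<open>e\<close>.\<close>
    define e where "e = r / 5"
    have e: "e > 0" using \<open>r > 0\<close> by (simp add: e_def)
    obtain h a where h: "h \<in> bcontfun" "\<And>t. 0 \<le> h t" "\<And>t. h t \<le> 1"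
      "\<And>t. h t \<noteq> 0 \<Longrightarrow> t \<in> {-a..a}" and tail: "(\<integral>z. (\<Prod>x\<in>J. h (z x)) \<partial>\<nu>) > 1 - e / B'"
      using product_cutoff[OF J \<nu>, of "e / B'"] e B'_pos by auto
    define \<phi> where "\<phi> z = (\<Prod>x\<in>J. h (z x))" for z
    have \<phi>: "\<phi> \<in> product_algebra J"
      using product_algebra.product[of "\<lambda>_. h" 1 J] h(1) by (simp add: \<phi>_def[abs_def])
    have \<phi>_range: "0 \<le> \<phi> z" "\<phi> z \<le> 1" for z
      using h(2,3) by (auto simp: \<phi>_def intro!: prod_nonneg prod_le_1)
    obtain g where g: "g \<in> product_algebra J"
      "\<And>z. z \<in> PiE J (\<lambda>_. {-a..a}) \<Longrightarrow> \<bar>f z - g z\<bar> < e"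
      using product_algebra_dense[OF J f e, of a] by metis
    have g\<phi>: "(\<lambda>z. g z * \<phi> z) \<in> product_algebra J" by (rule product_algebra_mult[OF g(1) \<phi>])
    have ptw: "\<bar>f z - g z * \<phi> z\<bar> \<le> B' * (1 - \<phi> z) + e" if z: "z \<in> PiE J (\<lambda>_. UNIV)" for z
    proof -
      have "\<bar>f z - g z\<bar> * \<phi> z \<le> e"
      proof (cases "\<phi> z = 0")
        case False
        then have "z \<in> PiE J (\<lambda>_. {-a..a})"
          using z h(4) J unfolding \<phi>_def by (auto simp: PiE_iff)
        from mult_mono[OF less_imp_le[OF g(2)[OF this]] \<phi>_range(2)[of z]] e \<phi>_range(1)[of z]
        show ?thesis by simp
      qed (use e in simp)
      moreover have "\<bar>f z\<bar> * (1 - \<phi> z) \<le> B' * (1 - \<phi> z)"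
        using B[OF z] \<phi>_range(2)[of z] by (intro mult_right_mono) (auto simp: B'_def)
      moreover have "\<bar>f z - g z * \<phi> z\<bar> \<le> \<bar>f z * (1 - \<phi> z)\<bar> + \<bar>(f z - g z) * \<phi> z\<bar>"
        by (rule order_trans[OF _ abs_triangle_ineq]) (simp add: algebra_simps)
      ultimately show ?thesis using \<phi>_range[of z] by (simp add: abs_mult)
    qed
    have int: "\<bar>(\<integral>z. f z \<partial>\<rho>) - (\<integral>z. g z * \<phi> z \<partial>\<rho>)\<bar> \<le> B' * (1 - (\<integral>z. \<phi> z \<partial>\<rho>)) + e"
      if \<rho>: "prob_space \<rho>" "sets \<rho> = sets (PiM J (\<lambda>_. borel))" for \<rho>
    proof -
      interpret prob_space \<rho> by fact
      have sp: "space \<rho> = PiE J (\<lambda>_. UNIV)"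
        using sets_eq_imp_space_eq[OF \<rho>(2)] by (simp add: space_PiM)
      have "f \<in> borel_measurable \<rho>"
        unfolding measurable_cong_sets[OF \<rho>(2) refl]
        by (rule continuous_map_product_measurable[OF J f])
      then have if': "integrable \<rho> f"
        by (intro integrable_const_bound[of _ "max 1 B"]) (use B sp in auto)
      note ig = product_algebra_integrable[OF g\<phi> \<rho>] and i\<phi> = product_algebra_integrable[OF \<phi> \<rho>]
      have "\<bar>\<integral>z. f z - g z * \<phi> z \<partial>\<rho>\<bar> \<le> (\<integral>z. \<bar>f z - g z * \<phi> z\<bar> \<partial>\<rho>)"
        by (rule integral_abs_bound)
      also have "\<dots> \<le> (\<integral>z. B' * (1 - \<phi> z) + e \<partial>\<rho>)"
        by (intro integral_mono) (use ptw sp if' ig i\<phi> in auto)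
      also have "\<dots> = B' * (1 - (\<integral>z. \<phi> z \<partial>\<rho>)) + e"
        using i\<phi> by (simp add: prob_space)
      finally show ?thesis using if' ig by simp
    qed
    have "eventually (\<lambda>j. (\<integral>z. \<phi> z \<partial>\<mu> j) > 1 - e / B') sequentially"
      by (rule order_tendstoD(1)[OF conv'[OF \<phi>]]) (use tail in \<open>simp add: \<phi>_def[abs_def]\<close>)
    moreover have "eventually (\<lambda>j. \<bar>(\<integral>z. g z * \<phi> z \<partial>\<mu> j) - (\<integral>z. g z * \<phi> z \<partial>\<nu>)\<bar> < e) sequentially"
      using tendstoD[OF conv'[OF g\<phi>] e] by (simp add: dist_real_def)
    ultimately have "eventually (\<lambda>j. norm ((\<integral>z. f z \<partial>\<mu> j) - (\<integral>z. f z \<partial>\<nu>)) < r) sequentially"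
    proof eventually_elim
      case (elim j)
      have *: "B' * (1 - t) < e" if "t > 1 - e / B'" for t
        using that B'_pos by (simp add: field_simps)
      have "B' * (1 - (\<integral>z. \<phi> z \<partial>\<mu> j)) < e" "B' * (1 - (\<integral>z. \<phi> z \<partial>\<nu>)) < e"
        using elim(1) tail by (auto intro!: * simp: \<phi>_def[abs_def])
      with int[OF \<mu>(1) \<mu>(2), of j] int[OF \<nu>] elim(2) show ?case
        unfolding e_def real_norm_def by linarith
    qed
    then show "\<exists>no. \<forall>n\<ge>no. norm ((\<integral>z. f z \<partial>\<mu> n) - (\<integral>z. f z \<partial>\<nu>)) < r"
      by (simp add: eventually_sequentially)
  qed
qed

section \<open>Extension of limiting finite-dimensional distributions to a random field\<close>

lemma restrict_field_measurable:
  "X \<in> M \<rightarrow>\<^sub>M field_space \<Longrightarrow> (\<lambda>\<omega>. restrict (X \<omega>) J) \<in> M \<rightarrow>\<^sub>M PiM J (\<lambda>_. borel)"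
  by (rule measurable_compose[OF _ measurable_restrict_subset]) auto

lemma sets_fdd: "sets (fdd M X J) = sets (PiM J (\<lambda>_. borel))"
  by (simp add: fdd_def)

lemma prob_space_fdd:
  assumes "prob_space M" "X \<in> M \<rightarrow>\<^sub>M field_space" shows "prob_space (fdd M X J)"
  unfolding fdd_def
  by (rule prob_space.prob_space_distr[OF assms(1) restrict_field_measurable[OF assms(2)]])

lemma integral_fdd_product:
  fixes h :: "'i \<Rightarrow> real \<Rightarrow> real"
  assumes X: "X \<in> M \<rightarrow>\<^sub>M field_space" and h: "\<And>x. h x \<in> bcontfun"
  shows "(\<integral>z. (\<Prod>x\<in>J. h x (z x)) \<partial>fdd M X J) = (\<integral>\<omega>. (\<Prod>x\<in>J. h x (X \<omega> x)) \<partial>M)"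
proof -
  have "(\<integral>z. (\<Prod>x\<in>J. h x (z x)) \<partial>fdd M X J)
      = (\<integral>\<omega>. (\<Prod>x\<in>J. h x (restrict (X \<omega>) J x)) \<partial>M)"
    unfolding fdd_def
    by (rule integral_distr[OF restrict_field_measurable[OF X] product_test_measurable])
       (use h in auto)
  also have "\<dots> = (\<integral>\<omega>. (\<Prod>x\<in>J. h x (X \<omega> x)) \<partial>M)"
    by (intro Bochner_Integration.integral_cong refl prod.cong) simp_all
  finally show ?thesis .
qed

lemma fdd_converges_productD:
  fixes h :: "'i \<Rightarrow> real \<Rightarrow> real"
  assumes conv: "fdd_converges M X N Y" and J: "finite J" and h: "\<And>x. h x \<in> bcontfun"
    and X: "\<And>j. X j \<in> M j \<rightarrow>\<^sub>M field_space" and Y: "Y \<in> N \<rightarrow>\<^sub>M field_space"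
  shows "(\<lambda>j. \<integral>\<omega>. (\<Prod>x\<in>J. h x (X j \<omega> x)) \<partial>M j) \<longlonglongrightarrow> (\<integral>\<omega>. (\<Prod>x\<in>J. h x (Y \<omega> x)) \<partial>N)"
proof -
  have "weakly_converges (product_topology (\<lambda>_. euclideanreal) J) (\<lambda>j. fdd (M j) (X j) J) (fdd N Y J)"
    using conv J by (simp add: fdd_converges_def)
  from weakly_converges_productD[where h = h, OF this J h] show ?thesis
    using X Y h by (simp add: integral_fdd_product)
qed

text \<open>If the product functionals of every finite-dimensional distribution converge to those of
  some law, then these laws form a projective family: the functional of a marginal is the functional of
  the larger law with test function \<open>1\<close> at the additional points, so both are limits of the same
  sequence.  Kolmogorov's extension theorem produces the limiting field, as the coordinate process.\<close>

lemma fdd_limit_exists: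
  fixes X :: "nat \<Rightarrow> 'a \<Rightarrow> 'i \<Rightarrow> real"
  assumes X: "\<And>j. random_field (M j) (X j)"
    and ex: "\<And>J. finite J \<Longrightarrow> \<exists>\<mu>. prob_space \<mu> \<and> sets \<mu> = sets (PiM J (\<lambda>_. borel)) \<and>
      (\<forall>h :: 'i \<Rightarrow> real \<Rightarrow> real. (\<forall>x. h x \<in> bcontfun) \<longrightarrow>
        (\<lambda>j. \<integral>\<omega>. (\<Prod>x\<in>J. h x (X j \<omega> x)) \<partial>M j) \<longlonglongrightarrow> (\<integral>z. (\<Prod>x\<in>J. h x (z x)) \<partial>\<mu>))"
  shows "\<exists>(N :: ('i \<Rightarrow> real) measure) Y. random_field N Y \<and> fdd_converges M X N Y"
proof -
  have Xm: "X j \<in> M j \<rightarrow>\<^sub>M field_space" "prob_space (M j)" for j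
    using X[of j] by (simp_all add: random_field_def)
  have "\<forall>J. \<exists>\<mu>. finite J \<longrightarrow> prob_space \<mu> \<and> sets \<mu> = sets (PiM J (\<lambda>_. borel)) \<and>
      (\<forall>h :: 'i \<Rightarrow> real \<Rightarrow> real. (\<forall>x. h x \<in> bcontfun) \<longrightarrow>
        (\<lambda>j. \<integral>\<omega>. (\<Prod>x\<in>J. h x (X j \<omega> x)) \<partial>M j) \<longlonglongrightarrow> (\<integral>z. (\<Prod>x\<in>J. h x (z x)) \<partial>\<mu>))"
    using ex by blast
  from choice[OF this] obtain P :: "'i set \<Rightarrow> ('i \<Rightarrow> real) measure" where
    P_all: "\<forall>J. finite J \<longrightarrow> prob_space (P J) \<and> sets (P J) = sets (PiM J (\<lambda>_. borel)) \<and>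
      (\<forall>h :: 'i \<Rightarrow> real \<Rightarrow> real. (\<forall>x. h x \<in> bcontfun) \<longrightarrow>
        (\<lambda>j. \<integral>\<omega>. (\<Prod>x\<in>J. h x (X j \<omega> x)) \<partial>M j) \<longlonglongrightarrow> (\<integral>z. (\<Prod>x\<in>J. h x (z x)) \<partial>P J))"
    by (elim exE)
  have margin: "prob_space (P J)" "sets (P J) = sets (PiM J (\<lambda>_. borel))" if "finite J" for J
    using P_all that by simp_all
  have lim: "(\<lambda>j. \<integral>\<omega>. (\<Prod>x\<in>J. h x (X j \<omega> x)) \<partial>M j) \<longlonglongrightarrow> (\<integral>z. (\<Prod>x\<in>J. h x (z x)) \<partial>P J)"
    if "finite J" "\<And>x. h x \<in> bcontfun" for J and h :: "'i \<Rightarrow> real \<Rightarrow> real"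
    using P_all that by simp
  have proj: "P J = distr (P H) (PiM J (\<lambda>_. borel)) (\<lambda>f. restrict f J)"
    if JH: "J \<subseteq> H" and H: "finite H" for J H
  proof (rule measure_eqI_products[of J])
    show J: "finite J" using JH H by (rule finite_subset)
    show "prob_space (P J)" "sets (P J) = sets (PiM J (\<lambda>_. borel))" using margin[OF J] .
    have r: "(\<lambda>f. restrict f J) \<in> P H \<rightarrow>\<^sub>M PiM J (\<lambda>_. borel)"
      unfolding measurable_cong_sets[OF margin(2)[OF H] refl] by (rule measurable_restrict_subset[OF JH])
    show "prob_space (distr (P H) (PiM J (\<lambda>_. borel)) (\<lambda>f. restrict f J))"
      by (rule prob_space.prob_space_distr[OF margin(1)[OF H] r])
    show "sets (distr (P H) (PiM J (\<lambda>_. borel)) (\<lambda>f. restrict f J)) = sets (PiM J (\<lambda>_. borel))"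
      by simp
    fix h :: "'i \<Rightarrow> real \<Rightarrow> real" assume h: "\<And>x. h x \<in> bcontfun"
    let ?k = "\<lambda>x. if x \<in> J then h x else (\<lambda>_. 1)"
    have k: "?k x \<in> bcontfun" for x using h by (simp add: bcontfun_const)
    have pk: "(\<Prod>x\<in>H. ?k x (z x)) = (\<Prod>x\<in>J. h x (z x))" for z
      using JH H by (intro prod.mono_neutral_cong_right) auto
    have "(\<integral>z. (\<Prod>x\<in>J. h x (z x)) \<partial>distr (P H) (PiM J (\<lambda>_. borel)) (\<lambda>f. restrict f J))
        = (\<integral>z. (\<Prod>x\<in>J. h x (restrict z J x)) \<partial>P H)"
      by (rule integral_distr[OF r product_test_measurable]) (use h in auto)
    also have "\<dots> = (\<integral>z. (\<Prod>x\<in>J. h x (z x)) \<partial>P H)"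
      by (intro Bochner_Integration.integral_cong refl prod.cong) simp_all
    also have "\<dots> = (\<integral>z. (\<Prod>x\<in>J. h x (z x)) \<partial>P J)"
      using lim[OF H, of ?k, OF k] lim[OF J, of h, OF h] unfolding pk by (rule LIMSEQ_unique)
    finally show "(\<integral>z. (\<Prod>x\<in>J. h x (z x)) \<partial>P J)
        = (\<integral>z. (\<Prod>x\<in>J. h x (z x)) \<partial>distr (P H) (PiM J (\<lambda>_. borel)) (\<lambda>f. restrict f J))" ..
  qed
  interpret polish_projective UNIV P
    by (intro polish_projective.intro projective_family.intro) (rule proj margin(1); assumption)+
  have Ym: "(\<lambda>z. z) \<in> lim \<rightarrow>\<^sub>M field_space"
    by (rule measurable_ident_sets) simp
  have fddP: "fdd lim (\<lambda>z. z) J = P J" if J: "finite J" for J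
  proof (rule measure_eqI)
    show "sets (fdd lim (\<lambda>z. z) J) = sets (P J)" using margin(2)[OF J] by (simp add: sets_fdd)
    fix A assume "A \<in> sets (fdd lim (\<lambda>z. z) J)"
    then have A: "A \<in> sets (PiM J (\<lambda>_. borel))" by (simp add: sets_fdd)
    have "emeasure (fdd lim (\<lambda>z. z) J) A = emeasure lim ((\<lambda>z. restrict z J) -` A \<inter> space lim)"
      unfolding fdd_def by (rule emeasure_distr[OF restrict_field_measurable[OF Ym] A])
    also have "(\<lambda>z. restrict z J) -` A \<inter> space lim = emb UNIV J A"
      by (simp add: prod_emb_def space_PiM)
    also have "emeasure lim (emb UNIV J A) = emeasure (P J) A"
      using J A by (intro emeasure_lim_emb) auto
    finally show "emeasure (fdd lim (\<lambda>z. z) J) A = emeasure (P J) A" .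
  qed
  have "fdd_converges M X lim (\<lambda>z. z)"
    unfolding fdd_converges_def
  proof (intro allI impI)
    fix J :: "'i set" assume J: "finite J"
    show "weakly_converges (product_topology (\<lambda>_. euclideanreal) J) (\<lambda>j. fdd (M j) (X j) J)
        (fdd lim (\<lambda>z. z) J)"
      unfolding fddP[OF J]
    proof (rule weakly_converges_productI[OF J prob_space_fdd[OF Xm(2,1)] sets_fdd margin[OF J]])
      fix h :: "'i \<Rightarrow> real \<Rightarrow> real" assume h: "\<And>x. h x \<in> bcontfun"
      show "(\<lambda>j. \<integral>z. (\<Prod>x\<in>J. h x (z x)) \<partial>fdd (M j) (X j) J) \<longlonglongrightarrow> (\<integral>z. (\<Prod>x\<in>J. h x (z x)) \<partial>P J)"
        using lim[OF J, of h, OF h] by (simp add: integral_fdd_product[OF Xm(1) h])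
    qed
  qed
  moreover have "random_field lim (\<lambda>z. z)"
    using Ym P.prob_space_axioms by (simp add: random_field_def)
  ultimately show ?thesis by (intro exI conjI)
qed

section \<open>Coloring finitely many points by a random labelling\<close>

text \<open>A labelling assigns to each point the index of its color source, or \<open>None\<close> for points that
  receive the color \<open>0\<close>.  Both the cells of a tessellation and the arbitrary representatives chosen for
  the limit object are labellings.\<close>

definition color_at :: "(nat \<Rightarrow> 'x \<Rightarrow> real) \<Rightarrow> ('x \<Rightarrow> nat option) \<Rightarrow> 'x \<Rightarrow> real" where
  "color_at c l x = (case l x of None \<Rightarrow> 0 | Some i \<Rightarrow> c i x)"

text \<open>The pattern forgets the labels and keeps which points of \<open>J\<close> share one; it is a partial
  equivalence relation whose domain is the set of labelled points.\<close>

definition pattern :: "'x set \<Rightarrow> ('x \<Rightarrow> nat option) \<Rightarrow> ('x \<times> 'x) set" where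
  "pattern J l = {(x, y) \<in> J \<times> J. l x \<noteq> None \<and> l x = l y}"

text \<open>The mean of \<open>\<Prod>x\<in>J. h x (color of x)\<close> given the pattern \<open>Q\<close>: uncolored points contribute
  \<open>h x 0\<close>, and each class \<open>B\<close> of \<open>Q\<close> contributes the mean \<open>m B\<close> of \<open>\<Prod>x\<in>B. h x (c x)\<close> for a single copy \<open>c\<close>
  of the field.\<close>

definition pattern_mean ::
  "'x set \<Rightarrow> ('x \<Rightarrow> real \<Rightarrow> real) \<Rightarrow> ('x set \<Rightarrow> real) \<Rightarrow> ('x \<times> 'x) set \<Rightarrow> real" where
  "pattern_mean J h m Q =
     (\<Prod>x\<in>{x \<in> J. (x, x) \<notin> Q}. h x 0) * (\<Prod>B\<in>(\<lambda>x. Q `` {x}) ` {x \<in> J. (x, x) \<in> Q}. m B)"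

lemma pattern_mean_cong:
  assumes "\<And>B. B \<subseteq> J \<Longrightarrow> m B = m' B" "Q \<subseteq> J \<times> J"
  shows "pattern_mean J h m Q = pattern_mean J h m' Q"
  unfolding pattern_mean_def
  by (intro arg_cong2[where f = "(*)"] refl prod.cong assms(1)) (use assms(2) in blast)

lemma tendsto_pattern_mean:
  assumes "\<And>B. B \<subseteq> J \<Longrightarrow> (\<lambda>j. m j B) \<longlonglongrightarrow> m' B" "Q \<subseteq> J \<times> J"
  shows "(\<lambda>j. pattern_mean J h (m j) Q) \<longlonglongrightarrow> pattern_mean J h m' Q"
  unfolding pattern_mean_def
  by (intro tendsto_mult tendsto_const tendsto_prod assms(1)) (use assms(2) in blast)

lemma indep_vars_PiM_coordinates:
  fixes D :: "'b measure"
  assumes "prob_space D"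
  shows "prob_space.indep_vars (PiM UNIV (\<lambda>_ :: 'k. D)) (\<lambda>_. D) (\<lambda>i c. c i) UNIV"
proof -
  interpret D: prob_space D by fact
  interpret product_prob_space "\<lambda>_ :: 'k. D" UNIV ..
  have "distr (PiM UNIV (\<lambda>_ :: 'k. D)) (PiM UNIV (\<lambda>_. D)) (\<lambda>c. \<lambda>i\<in>UNIV. c i)
      = PiM UNIV (\<lambda>_. D)"
    by (simp add: distr_id restrict_UNIV)
  then show ?thesis
    by (subst P.indep_vars_iff_distr_eq_PiM) (simp_all add: PiM_component)
qed

text \<open>Group the points of \<open>J\<close> by label.  Different labels use independent copies of the field, so the
  mean factorizes over the classes, and since the copies have the same law the factors depend on the
  classes but not on the labels.\<close>

lemma integral_color_at:
  fixes h :: "'x \<Rightarrow> real \<Rightarrow> real"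
  assumes D: "prob_space D" "sets D = sets field_space"
    and J: "finite J" and h: "\<And>x. h x \<in> bcontfun"
  shows "(\<integral>c. (\<Prod>x\<in>J. h x (color_at c l x)) \<partial>PiM UNIV (\<lambda>_. D))
    = pattern_mean J h (\<lambda>B. \<integral>c. (\<Prod>x\<in>B. h x (c x)) \<partial>D) (pattern J l)"
proof -
  let ?N = "PiM UNIV (\<lambda>_ :: nat. D)"
  interpret D: prob_space D by fact
  interpret product_prob_space "\<lambda>_ :: nat. D" UNIV ..
  define Z where "Z = {x \<in> J. l x = None}"
  define S where "S = {x \<in> J. l x \<noteq> None}"
  define K where "K = (\<lambda>x. the (l x)) ` S"
  define cell where "cell i = {x \<in> J. l x = Some i}" for i
  have fin: "finite Z" "finite S" "finite K" using J by (auto simp: Z_def S_def K_def)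
  have ZS: "J = Z \<union> S" "Z \<inter> S = {}" by (auto simp: Z_def S_def)
  have cell_eq: "{x \<in> S. the (l x) = i} = cell i" for i by (auto simp: S_def cell_def)
  have blocks: "(\<lambda>x. pattern J l `` {x}) ` {x \<in> J. (x, x) \<in> pattern J l} = cell ` K"
  proof -
    have "{x \<in> J. (x, x) \<in> pattern J l} = S" by (auto simp: pattern_def S_def)
    moreover have "pattern J l `` {x} = cell (the (l x))" if "x \<in> S" for x
      using that by (auto simp: pattern_def S_def cell_def)
    ultimately show ?thesis unfolding K_def image_image by (intro image_cong) auto
  qed
  have zero: "{x \<in> J. (x, x) \<notin> pattern J l} = Z" by (auto simp: pattern_def Z_def)
  have inj: "inj_on cell K"
    by (rule inj_onI) (auto simp: K_def S_def cell_def dest!: equalityD1)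
  have split: "(\<Prod>x\<in>J. h x (color_at c l x)) = (\<Prod>x\<in>Z. h x 0) * (\<Prod>i\<in>K. \<Prod>x\<in>cell i. h x (c i x))" for c
  proof -
    have "(\<Prod>x\<in>J. h x (color_at c l x))
        = (\<Prod>x\<in>Z. h x (color_at c l x)) * (\<Prod>x\<in>S. h x (color_at c l x))"
      unfolding ZS(1) using fin ZS(2) by (intro prod.union_disjoint)
    also have "(\<Prod>x\<in>Z. h x (color_at c l x)) = (\<Prod>x\<in>Z. h x 0)"
      by (rule prod.cong) (auto simp: Z_def color_at_def)
    also have "(\<Prod>x\<in>S. h x (color_at c l x)) = (\<Prod>i\<in>K. \<Prod>x\<in>cell i. h x (color_at c l x))"
      unfolding K_def cell_eq[symmetric] using fin by (intro prod.image_gen)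
    also have "\<dots> = (\<Prod>i\<in>K. \<Prod>x\<in>cell i. h x (c i x))"
      by (intro prod.cong refl) (auto simp: cell_def color_at_def)
    finally show ?thesis .
  qed
  have meas: "(\<lambda>c. \<Prod>x\<in>B. h x (c x)) \<in> borel_measurable D" for B
    unfolding measurable_cong_sets[OF D(2) refl] by (rule product_test_measurable) (use h in auto)
  have indep: "P.indep_vars (\<lambda>_. borel) (\<lambda>i c. \<Prod>x\<in>cell i. h x (c i x)) K"
    using P.indep_vars_compose2[OF indep_vars_PiM_coordinates[OF D(1)], of "\<lambda>i c. \<Prod>x\<in>cell i. h x (c x)" "\<lambda>_. borel"]
      meas by (auto intro: P.indep_vars_subset)
  have marginal: "(\<integral>c. (\<Prod>x\<in>B. h x (c i x)) \<partial>?N) = (\<integral>c. (\<Prod>x\<in>B. h x (c x)) \<partial>D)" for i B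
    using integral_distr[of "\<lambda>c. c i" ?N D "\<lambda>c. \<Prod>x\<in>B. h x (c x)"] meas
    by (simp add: PiM_component)
  have int: "integrable ?N (\<lambda>c. \<Prod>x\<in>cell i. h x (c i x))" for i
  proof -
    obtain B where B: "\<And>z. \<bar>\<Prod>x\<in>cell i. h x (z x)\<bar> \<le> B"
      by (rule product_test_bound[where J = "cell i" and h = h]) (rule h, blast)
    show ?thesis
      by (rule P.integrable_const_bound[of _ B])
         (use B measurable_compose[OF measurable_component_singleton[of i UNIV "\<lambda>_. D"] meas] in auto)
  qed
  have "(\<integral>c. (\<Prod>x\<in>J. h x (color_at c l x)) \<partial>?N)
      = (\<Prod>x\<in>Z. h x 0) * (\<integral>c. (\<Prod>i\<in>K. \<Prod>x\<in>cell i. h x (c i x)) \<partial>?N)"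
    unfolding split by simp
  also have "(\<integral>c. (\<Prod>i\<in>K. \<Prod>x\<in>cell i. h x (c i x)) \<partial>?N)
      = (\<Prod>i\<in>K. \<integral>c. (\<Prod>x\<in>cell i. h x (c i x)) \<partial>?N)"
    by (rule P.indep_vars_lebesgue_integral[OF fin(3) indep int])
  also have "\<dots> = (\<Prod>B\<in>cell ` K. \<integral>c. (\<Prod>x\<in>B. h x (c x)) \<partial>D)"
    by (simp add: marginal prod.reindex[OF inj])
  finally show ?thesis
    unfolding pattern_mean_def blocks zero .
qed

lemma color_at_measurable:
  fixes l :: "'p \<Rightarrow> 'x \<Rightarrow> nat option"
  assumes l: "(\<lambda>p. l p x) \<in> P \<rightarrow>\<^sub>M count_space UNIV" and D: "sets D = sets field_space"
  shows "(\<lambda>z. color_at (snd z) (l (fst z)) x) \<in> borel_measurable (P \<Otimes>\<^sub>M PiM UNIV (\<lambda>_. D))"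
proof -
  have "(\<lambda>z. (\<lambda>k z. case k of None \<Rightarrow> 0 | Some i \<Rightarrow> snd z i x) (l (fst z) x) z)
      \<in> borel_measurable (P \<Otimes>\<^sub>M PiM UNIV (\<lambda>_. D))"
  proof (rule measurable_compose_countable)
    show "(\<lambda>z. l (fst z) x) \<in> P \<Otimes>\<^sub>M PiM UNIV (\<lambda>_. D) \<rightarrow>\<^sub>M count_space UNIV"
      by (rule measurable_compose[OF measurable_fst l])
    fix k :: "nat option"
    show "(\<lambda>z. case k of None \<Rightarrow> 0 | Some i \<Rightarrow> snd z i x) \<in> borel_measurable (P \<Otimes>\<^sub>M PiM UNIV (\<lambda>_. D))"
    proof (cases k)
      case (Some i)
      have "(\<lambda>c. c x) \<in> borel_measurable D"
        unfolding measurable_cong_sets[OF D refl] by (rule measurable_component_singleton) simp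
      moreover have "(\<lambda>c. c i) \<in> PiM UNIV (\<lambda>_. D) \<rightarrow>\<^sub>M D"
        by (rule measurable_component_singleton) simp
      ultimately have "(\<lambda>c. c i x) \<in> borel_measurable (PiM UNIV (\<lambda>_. D))"
        by (rule measurable_compose[rotated])
      from measurable_compose[OF measurable_snd this] show ?thesis by (simp add: Some)
    qed simp
  qed
  then show ?thesis by (simp add: color_at_def)
qed

text \<open>Labels independent of the colors: by Fubini the colors are integrated first, with the
  labelling held fixed.\<close>

lemma integral_random_pattern:
  fixes h :: "'x \<Rightarrow> real \<Rightarrow> real" and l :: "'p \<Rightarrow> 'x \<Rightarrow> nat option"
  assumes P: "prob_space P" and D: "prob_space D" "sets D = sets field_space"
    and J: "finite J" and h: "\<And>x. h x \<in> bcontfun"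
    and l: "\<And>x. x \<in> J \<Longrightarrow> (\<lambda>p. l p x) \<in> P \<rightarrow>\<^sub>M count_space UNIV"
  shows "(\<integral>z. (\<Prod>x\<in>J. h x (color_at (snd z) (l (fst z)) x)) \<partial>(P \<Otimes>\<^sub>M PiM UNIV (\<lambda>_. D)))
    = (\<integral>p. pattern_mean J h (\<lambda>B. \<integral>c. (\<Prod>x\<in>B. h x (c x)) \<partial>D) (pattern J (l p)) \<partial>P)"
proof -
  let ?N = "PiM UNIV (\<lambda>_ :: nat. D)"
  interpret P: prob_space P by fact
  interpret D: prob_space D by fact
  interpret DN: product_prob_space "\<lambda>_ :: nat. D" UNIV ..
  interpret PN: pair_prob_space P ?N ..
  have meas: "(\<lambda>z. \<Prod>x\<in>J. h x (color_at (snd z) (l (fst z)) x)) \<in> borel_measurable (P \<Otimes>\<^sub>M ?N)"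
    by (intro borel_measurable_prod measurable_compose[OF color_at_measurable[OF l D(2)] bcontfun_measurable[OF h]])
  obtain B where B: "\<And>z. \<bar>\<Prod>x\<in>J. h x (z x)\<bar> \<le> B"
    by (rule product_test_bound[where J = J and h = h]) (rule h, blast)
  have "integrable (P \<Otimes>\<^sub>M ?N) (\<lambda>z. \<Prod>x\<in>J. h x (color_at (snd z) (l (fst z)) x))"
    by (rule PN.integrable_const_bound[of _ B]) (use B meas in auto)
  then have "integrable (P \<Otimes>\<^sub>M ?N) (\<lambda>(p, c). \<Prod>x\<in>J. h x (color_at c (l p) x))"
    by (simp add: case_prod_unfold)
  from PN.integral_fst[OF this]
  have "(\<integral>z. (\<Prod>x\<in>J. h x (color_at (snd z) (l (fst z)) x)) \<partial>(P \<Otimes>\<^sub>M ?N))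
      = (\<integral>p. (\<integral>c. (\<Prod>x\<in>J. h x (color_at c (l p) x)) \<partial>?N) \<partial>P)"
    by (simp add: case_prod_unfold)
  then show ?thesis
    by (simp add: integral_color_at[where h = h, OF D J h])
qed

text \<open>On \<open>{0, 1}\<close> this is the indicator of \<open>(t = 1) = (p \<in> Q)\<close>; clamping \<open>t\<close> to \<open>[0, 1]\<close> extends it to a
  bounded continuous function.  The probability of a pattern thus becomes a product functional of the
  partition process, and weak convergence applies to it without reference to continuity sets.\<close>

definition pattern_factor :: "('x \<times> 'x) set \<Rightarrow> 'x \<times> 'x \<Rightarrow> real \<Rightarrow> real" where
  "pattern_factor Q p t = (if p \<in> Q then max 0 (min 1 t) else 1 - max 0 (min 1 t))"

lemma pattern_factor_bcontfun: "pattern_factor Q p \<in> bcontfun"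
proof -
  have "bounded (range (pattern_factor Q p))"
    by (rule bounded_subset[of "{0..1}"]) (auto simp: pattern_factor_def)
  moreover have "continuous_on UNIV (pattern_factor Q p)"
    unfolding pattern_factor_def[abs_def] by (cases "p \<in> Q") (auto intro!: continuous_intros)
  ultimately show ?thesis by (simp add: bcontfun_def)
qed

lemma prod_pattern_factor:
  assumes A: "finite A" and Q: "Q \<subseteq> A" and R: "\<And>p. p \<in> A \<Longrightarrow> R p \<in> {0, 1}"
  shows "(\<Prod>p\<in>A. pattern_factor Q p (R p)) = of_bool ({p \<in> A. R p = 1} = Q)"
proof -
  have "(\<Prod>p\<in>A. pattern_factor Q p (R p)) = (\<Prod>p\<in>A. of_bool ((R p = 1) = (p \<in> Q)))"
    by (rule prod.cong) (use R in \<open>force simp: pattern_factor_def\<close>)+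
  also have "\<dots> = of_bool (\<forall>p\<in>A. (R p = 1) = (p \<in> Q))"
    using A by (induction A) auto
  also have "(\<forall>p\<in>A. (R p = 1) = (p \<in> Q)) \<longleftrightarrow> {p \<in> A. R p = 1} = Q"
    using Q by blast
  finally show ?thesis .
qed

lemma integral_pattern_sum:
  fixes f :: "('x \<times> 'x) set \<Rightarrow> real"
  assumes P: "prob_space P" and R: "R \<in> P \<rightarrow>\<^sub>M field_space"
    and R01: "\<And>w p. w \<in> space P \<Longrightarrow> p \<in> A \<Longrightarrow> R w p \<in> {0, 1}" and A: "finite A"
  shows "(\<integral>w. f {p \<in> A. R w p = 1} \<partial>P)
    = (\<Sum>Q\<in>Pow A. f Q * (\<integral>w. (\<Prod>p\<in>A. pattern_factor Q p (R w p)) \<partial>P))"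
proof -
  interpret prob_space P by fact
  have int: "integrable P (\<lambda>w. \<Prod>p\<in>A. pattern_factor Q p (R w p))" for Q
  proof -
    obtain B where B: "\<And>z. \<bar>\<Prod>p\<in>A. pattern_factor Q p (z p)\<bar> \<le> B"
      by (rule product_test_bound[where J = A and h = "pattern_factor Q"])
         (rule pattern_factor_bcontfun, blast)
    have "(\<lambda>w. \<Prod>p\<in>A. pattern_factor Q p (R w p)) \<in> borel_measurable P"
      by (rule measurable_compose[OF R product_test_measurable]) (auto simp: pattern_factor_bcontfun)
    then show ?thesis by (intro integrable_const_bound[of _ B]) (use B in auto)
  qed
  have "(\<integral>w. f {p \<in> A. R w p = 1} \<partial>P)
      = (\<integral>w. (\<Sum>Q\<in>Pow A. f Q * (\<Prod>p\<in>A. pattern_factor Q p (R w p))) \<partial>P)"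
  proof (rule Bochner_Integration.integral_cong[OF refl])
    fix w assume w: "w \<in> space P"
    have "(\<Sum>Q\<in>Pow A. f Q * (\<Prod>p\<in>A. pattern_factor Q p (R w p)))
        = (\<Sum>Q\<in>Pow A. if {p \<in> A. R w p = 1} = Q then f Q else 0)"
      by (intro sum.cong refl) (simp add: prod_pattern_factor[OF A _ R01[OF w]])
    also have "\<dots> = f {p \<in> A. R w p = 1}"
      using A by (subst sum.delta') auto
    finally show "f {p \<in> A. R w p = 1} = (\<Sum>Q\<in>Pow A. f Q * (\<Prod>p\<in>A. pattern_factor Q p (R w p)))" ..
  qed
  also have "\<dots> = (\<Sum>Q\<in>Pow A. f Q * (\<integral>w. (\<Prod>p\<in>A. pattern_factor Q p (R w p)) \<partial>P))"
    using int by simp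
  finally show ?thesis .
qed

lemma finite_random_set_measurable:
  assumes \<Phi>: "\<And>q. q \<in> A \<Longrightarrow> Measurable.pred P (\<lambda>w. \<Phi> w q)" and A: "finite A"
  shows "(\<lambda>w. {q \<in> A. \<Phi> w q}) \<in> P \<rightarrow>\<^sub>M count_space (Pow A)"
proof (subst measurable_count_space_eq2)
  show "finite (Pow A)" using A by simp
  have "(\<lambda>w. {q \<in> A. \<Phi> w q}) -` {Q} \<inter> space P \<in> sets P" if Q: "Q \<in> Pow A" for Q
  proof -
    have "(\<lambda>w. {q \<in> A. \<Phi> w q}) -` {Q} \<inter> space P = {w \<in> space P. \<forall>q\<in>A. \<Phi> w q = (q \<in> Q)}"
      using Q by auto
    also have "\<dots> \<in> sets P"
    proof (rule sets.sets_Collect_finite_All[OF _ A])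
      fix q assume "q \<in> A"
      note [measurable] = \<Phi>[OF this]
      show "{w \<in> space P. \<Phi> w q = (q \<in> Q)} \<in> sets P" by measurable
    qed
    finally show ?thesis .
  qed
  then show "(\<lambda>w. {q \<in> A. \<Phi> w q}) \<in> space P \<rightarrow> Pow A \<and>
      (\<forall>a\<in>Pow A. (\<lambda>w. {q \<in> A. \<Phi> w q}) -` {a} \<inter> space P \<in> sets P)"
    by auto
qed

lemma level_set_measurable:
  assumes R: "R \<in> P \<rightarrow>\<^sub>M field_space" and A: "finite A"
  shows "(\<lambda>w. {p \<in> A. R w p = (1 :: real)}) \<in> P \<rightarrow>\<^sub>M count_space (Pow A)"
proof (rule finite_random_set_measurable[OF _ A])
  fix p
  have [measurable]: "(\<lambda>w. R w p) \<in> borel_measurable P"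
    by (rule measurable_compose[OF R measurable_component_singleton]) simp
  show "Measurable.pred P (\<lambda>w. R w p = 1)" by measurable
qed

lemma pattern_measurable:
  assumes l: "\<And>x. x \<in> J \<Longrightarrow> (\<lambda>p. l p x) \<in> P \<rightarrow>\<^sub>M count_space UNIV" and J: "finite J"
  shows "(\<lambda>p. pattern J (l p)) \<in> P \<rightarrow>\<^sub>M count_space (Pow (J \<times> J))"
proof -
  have "(\<lambda>p. {q \<in> J \<times> J. \<exists>i. l p (fst q) = Some i \<and> l p (snd q) = Some i})
      \<in> P \<rightarrow>\<^sub>M count_space (Pow (J \<times> J))"
  proof (rule finite_random_set_measurable)
    fix q assume "q \<in> J \<times> J"
    then have [measurable]: "(\<lambda>p. l p (fst q)) \<in> P \<rightarrow>\<^sub>M count_space UNIV"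
      "(\<lambda>p. l p (snd q)) \<in> P \<rightarrow>\<^sub>M count_space UNIV"
      using l by auto
    show "Measurable.pred P (\<lambda>p. \<exists>i. l p (fst q) = Some i \<and> l p (snd q) = Some i)" by measurable
  qed (use J in auto)
  moreover have "{q \<in> J \<times> J. \<exists>i. l p (fst q) = Some i \<and> l p (snd q) = Some i} = pattern J (l p)" for p
  proof -
    have "(\<exists>i. l p x = Some i \<and> l p y = Some i) \<longleftrightarrow> l p x \<noteq> None \<and> l p x = l p y" for x y
      by (cases "l p x") auto
    then show ?thesis by (simp add: pattern_def set_eq_iff case_prod_unfold)
  qed
  ultimately show ?thesis by simp
qed

text \<open>The limit law on a finite set \<open>J\<close>.  A limit \<open>R\<close> of partition processes need not come from a
  tessellation, but almost surely its restriction to \<open>J \<times> J\<close> is the pattern of some labelling.  There are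
  only finitely many patterns, so one labelling is chosen for each of them, in a trivially measurable
  way, and the points are colored accordingly with independent copies of the field.\<close>

lemma coloring_of_random_pattern:
  fixes R :: "'r \<Rightarrow> 'x \<times> 'x \<Rightarrow> real"
  assumes P: "prob_space P" and R: "R \<in> P \<rightarrow>\<^sub>M field_space"
    and R01: "\<And>w p. w \<in> space P \<Longrightarrow> R w p \<in> {0, 1}"
    and D: "prob_space D" "sets D = sets field_space" and J: "finite J"
    and null: "\<And>Q. Q \<subseteq> J \<times> J \<Longrightarrow> Q \<notin> range (pattern J) \<Longrightarrow>
      (\<integral>w. (\<Prod>p\<in>J \<times> J. pattern_factor Q p (R w p)) \<partial>P) = 0"
  shows "\<exists>\<mu>. prob_space \<mu> \<and> sets \<mu> = sets (PiM J (\<lambda>_. borel)) \<and>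
    (\<forall>h :: 'x \<Rightarrow> real \<Rightarrow> real. (\<forall>x. h x \<in> bcontfun) \<longrightarrow>
      (\<integral>z. (\<Prod>x\<in>J. h x (z x)) \<partial>\<mu>)
      = (\<Sum>Q\<in>Pow (J \<times> J). pattern_mean J h (\<lambda>B. \<integral>c. (\<Prod>x\<in>B. h x (c x)) \<partial>D) Q
           * (\<integral>w. (\<Prod>p\<in>J \<times> J. pattern_factor Q p (R w p)) \<partial>P)))"
proof -
  let ?N = "PiM UNIV (\<lambda>_ :: nat. D)"
  define L where "L = inv (pattern J)"
  have L: "pattern J (L Q) = Q" if "Q \<in> range (pattern J)" for Q
    using that unfolding L_def by (rule f_inv_into_f)
  define l where "l w = L {p \<in> J \<times> J. R w p = 1}" for w
  have l: "(\<lambda>w. l w x) \<in> P \<rightarrow>\<^sub>M count_space UNIV" for x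
    unfolding l_def by (rule measurable_compose[OF level_set_measurable[OF R]]) (use J in auto)
  interpret P: prob_space P by fact
  interpret D: prob_space D by fact
  interpret DN: product_prob_space "\<lambda>_ :: nat. D" UNIV ..
  interpret PN: pair_prob_space P ?N ..
  define Y where "Y z = (\<lambda>x\<in>J. color_at (snd z) (l (fst z)) x)" for z
  have Y: "Y \<in> P \<Otimes>\<^sub>M ?N \<rightarrow>\<^sub>M PiM J (\<lambda>_. borel)"
    unfolding Y_def by (intro measurable_restrict color_at_measurable l D)
  show ?thesis
  proof (intro exI[of _ "distr (P \<Otimes>\<^sub>M ?N) (PiM J (\<lambda>_. borel)) Y"] conjI allI impI)
    show "prob_space (distr (P \<Otimes>\<^sub>M ?N) (PiM J (\<lambda>_. borel)) Y)"
      by (rule PN.prob_space_distr[OF Y])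
    fix h :: "'x \<Rightarrow> real \<Rightarrow> real" assume h: "\<forall>x. h x \<in> bcontfun"
    then have h': "\<And>x. h x \<in> bcontfun" by blast
    let ?m = "\<lambda>B. \<integral>c. (\<Prod>x\<in>B. h x (c x)) \<partial>D"
    have "(\<integral>z. (\<Prod>x\<in>J. h x (z x)) \<partial>distr (P \<Otimes>\<^sub>M ?N) (PiM J (\<lambda>_. borel)) Y)
        = (\<integral>z. (\<Prod>x\<in>J. h x (Y z x)) \<partial>(P \<Otimes>\<^sub>M ?N))"
      by (rule integral_distr[OF Y product_test_measurable]) (use h' in auto)
    also have "\<dots> = (\<integral>z. (\<Prod>x\<in>J. h x (color_at (snd z) (l (fst z)) x)) \<partial>(P \<Otimes>\<^sub>M ?N))"
      by (intro Bochner_Integration.integral_cong refl prod.cong) (simp add: Y_def)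
    also have "\<dots> = (\<integral>w. pattern_mean J h ?m (pattern J (l w)) \<partial>P)"
      by (rule integral_random_pattern[where h = h, OF P D J h' l])
    also have "\<dots> = (\<Sum>Q\<in>Pow (J \<times> J). pattern_mean J h ?m (pattern J (L Q))
        * (\<integral>w. (\<Prod>p\<in>J \<times> J. pattern_factor Q p (R w p)) \<partial>P))"
      unfolding l_def by (rule integral_pattern_sum[OF P R R01]) (use J in auto)
    also have "\<dots> = (\<Sum>Q\<in>Pow (J \<times> J). pattern_mean J h ?m Q
        * (\<integral>w. (\<Prod>p\<in>J \<times> J. pattern_factor Q p (R w p)) \<partial>P))"
    proof (rule sum.cong[OF refl])
      fix Q assume "Q \<in> Pow (J \<times> J)"
      \<comment> \<open>Relations that are not patterns carry no mass, so it does not matter how they are labelled.\<close>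
      then show "pattern_mean J h ?m (pattern J (L Q))
          * (\<integral>w. (\<Prod>p\<in>J \<times> J. pattern_factor Q p (R w p)) \<partial>P)
        = pattern_mean J h ?m Q * (\<integral>w. (\<Prod>p\<in>J \<times> J. pattern_factor Q p (R w p)) \<partial>P)"
        using L[of Q] null[of Q] by (cases "Q \<in> range (pattern J)") auto
    qed
    finally show "(\<integral>z. (\<Prod>x\<in>J. h x (z x)) \<partial>distr (P \<Otimes>\<^sub>M ?N) (PiM J (\<lambda>_. borel)) Y)
      = (\<Sum>Q\<in>Pow (J \<times> J). pattern_mean J h ?m Q
           * (\<integral>w. (\<Prod>p\<in>J \<times> J. pattern_factor Q p (R w p)) \<partial>P))" .
  qed simp
qed

section \<open>The cells of a random tessellation as a random labelling\<close>

abbreviation cells_space :: "(nat \<Rightarrow> (real^2) set) measure" where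
  "cells_space \<equiv> PiM UNIV (\<lambda>_. fell_borel)"

definition cell_label :: "(nat \<Rightarrow> (real^2) set) \<Rightarrow> real^2 \<Rightarrow> nat option" where
  "cell_label F x = (if x \<notin> tess_boundary F \<and> (\<exists>!i. x \<in> interior (F i))
     then Some (THE i. x \<in> interior (F i)) else None)"

lemma colored_eq_color_at: "colored F c x = color_at c (cell_label F) x"
  by (simp add: colored_def color_at_def cell_label_def)

lemma cell_label_eq_Some:
  "cell_label F x = Some i \<longleftrightarrow>
    x \<notin> tess_boundary F \<and> x \<in> interior (F i) \<and> (\<forall>k. x \<in> interior (F k) \<longrightarrow> k = i)"
proof -
  have "(THE k. x \<in> interior (F k)) = i"
    if "x \<in> interior (F i)" "\<forall>k. x \<in> interior (F k) \<longrightarrow> k = i"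
    using that by blast
  moreover have "x \<in> interior (F (THE k. x \<in> interior (F k)))" if "\<exists>!k. x \<in> interior (F k)"
    using that by (rule theI')
  ultimately show ?thesis unfolding cell_label_def by (smt (verit) option.inject option.distinct(1))
qed

text \<open>For a tessellation the pattern of the cell labels on a finite set is read off from the second
  order partition process; in particular \<open>partition2 F (x, x) = 1\<close> says that \<open>x\<close> is off the boundary.\<close>

lemma pattern_cell_label:
  assumes "tessellation F"
  shows "pattern J (cell_label F) = {p \<in> J \<times> J. partition2 F p = 1}"
proof -
  have uniq: "k = i" if "x \<in> interior (F i)" "x \<in> interior (F k)" for x i k
    using that assms unfolding tessellation_def by blast
  have "(cell_label F x \<noteq> None \<and> cell_label F x = cell_label F y) \<longleftrightarrow> partition2 F (x, y) = 1" for x y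
  proof -
    have "(cell_label F x \<noteq> None \<and> cell_label F x = cell_label F y)
        \<longleftrightarrow> (\<exists>i. cell_label F x = Some i \<and> cell_label F y = Some i)" by auto
    also have "\<dots> \<longleftrightarrow> (\<exists>i. x \<in> interior (F i) - tess_boundary F \<and> y \<in> interior (F i) - tess_boundary F)"
      unfolding cell_label_eq_Some using uniq by blast
    finally show ?thesis by (simp add: partition2_def)
  qed
  then show ?thesis by (auto simp: pattern_def)
qed

lemma fell_borel_generators: "{U. openin fell_topology U} \<subseteq> Pow (topspace fell_topology)"
  using openin_subset by blast

lemma space_fell_borel: "space fell_borel = {F. closed F}"
  unfolding fell_borel_def space_measure_of[OF fell_borel_generators] by (rule topspace_fell_topology)

lemma sets_fell_borel_openin: "openin fell_topology U \<Longrightarrow> U \<in> sets fell_borel"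
  unfolding fell_borel_def sets_measure_of[OF fell_borel_generators]
  by (rule sigma_sets.Basic) simp

text \<open>Points are compact, so the sets that miss a given point form a subbasic open set.\<close>

lemma point_in_cell_measurable: "Measurable.pred fell_borel (\<lambda>F. x \<in> F)"
proof -
  have "openin fell_topology {F. closed F \<and> F \<inter> {x} = {}}"
    unfolding fell_topology_def openin_topology_generated_by_iff
    by (rule generate_topology_on.Basis) (use compact_sing in blast)
  then have "space fell_borel - {F. closed F \<and> F \<inter> {x} = {}} \<in> sets fell_borel"
    by (intro sets.compl_sets sets_fell_borel_openin)
  also have "space fell_borel - {F. closed F \<and> F \<inter> {x} = {}} = {F \<in> space fell_borel. x \<in> F}"
    by (auto simp: space_fell_borel)
  finally show ?thesis by (simp add: pred_def)
qed

text \<open>Membership in the interior becomes a countable condition: a closed set contains a ball as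
  soon as it contains the points of a countable dense set that lie in the ball.\<close>

lemma mem_interior_closed_iff:
  fixes F :: "'v :: {real_normed_vector, second_countable_topology} set"
  assumes F: "closed F" and D: "\<And>U. open U \<Longrightarrow> U \<noteq> {} \<Longrightarrow> \<exists>d\<in>D. d \<in> U"
  shows "x \<in> interior F \<longleftrightarrow> (\<exists>n. \<forall>d\<in>D. dist x d < 1 / real (Suc n) \<longrightarrow> d \<in> F)"
proof
  assume "x \<in> interior F"
  then obtain e where e: "e > 0" "ball x e \<subseteq> F" by (auto simp: mem_interior)
  then obtain n where "1 / real (Suc n) < e" using nat_approx_posE by blast
  with e show "\<exists>n. \<forall>d\<in>D. dist x d < 1 / real (Suc n) \<longrightarrow> d \<in> F"
    by (intro exI[of _ n]) (auto simp: subset_iff)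
next
  assume "\<exists>n. \<forall>d\<in>D. dist x d < 1 / real (Suc n) \<longrightarrow> d \<in> F"
  then obtain n where n: "\<And>d. d \<in> D \<Longrightarrow> dist x d < 1 / real (Suc n) \<Longrightarrow> d \<in> F" by auto
  have "ball x (1 / real (Suc n)) \<subseteq> F"
  proof (rule ccontr)
    assume "\<not> ?thesis"
    then have "ball x (1 / real (Suc n)) - F \<noteq> {}" by blast
    then obtain d where "d \<in> D" "d \<in> ball x (1 / real (Suc n)) - F"
      using D[of "ball x (1 / real (Suc n)) - F"] F by (auto intro: open_Diff)
    then show False using n[of d] by auto
  qed
  then show "x \<in> interior F"
    by (auto simp: mem_interior intro!: exI[of _ "1 / real (Suc n)"])
qed

lemma interior_measurable: "Measurable.pred fell_borel (\<lambda>F. x \<in> interior F)"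
proof -
  obtain D :: "(real^2) set" where D: "countable D" "\<And>U. open U \<Longrightarrow> U \<noteq> {} \<Longrightarrow> \<exists>d\<in>D. d \<in> U"
    by (rule countable_dense_setE) blast
  note [measurable] = point_in_cell_measurable
  have "Measurable.pred fell_borel (\<lambda>F. \<exists>n. \<forall>d\<in>D. dist x d < 1 / real (Suc n) \<longrightarrow> d \<in> F)"
    using D(1) by measurable
  also have "?this \<longleftrightarrow> Measurable.pred fell_borel (\<lambda>F. x \<in> interior F)"
    by (rule measurable_cong) (simp add: space_fell_borel mem_interior_closed_iff[OF _ D(2)])
  finally show ?thesis .
qed

lemma cell_measurable:
  assumes "Measurable.pred fell_borel Q"
  shows "Measurable.pred cells_space (\<lambda>F. Q (F i))"
  by (rule measurable_compose[OF measurable_component_singleton[of i UNIV "\<lambda>_. fell_borel"] assms]) simp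

lemma tess_boundary_measurable: "Measurable.pred cells_space (\<lambda>F. x \<in> tess_boundary F)"
proof -
  note [measurable] = cell_measurable[OF point_in_cell_measurable] cell_measurable[OF interior_measurable]
  have "Measurable.pred cells_space (\<lambda>F. \<exists>i. x \<in> F i \<and> \<not> x \<in> interior (F i))"
    by measurable
  also have "?this \<longleftrightarrow> Measurable.pred cells_space (\<lambda>F. x \<in> tess_boundary F)"
    by (rule measurable_cong)
       (auto simp: space_PiM PiE_iff space_fell_borel tess_boundary_def frontier_def)
  finally show ?thesis .
qed

lemma cell_label_measurable: "(\<lambda>F. cell_label F x) \<in> cells_space \<rightarrow>\<^sub>M count_space UNIV"
proof -
  note [measurable] = tess_boundary_measurable cell_measurable[OF interior_measurable]
  have some: "{F \<in> space cells_space. cell_label F x = Some i} \<in> sets cells_space" for i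
    unfolding cell_label_eq_Some by measurable
  have "(\<lambda>F. cell_label F x) -` {k} \<inter> space cells_space \<in> sets cells_space" for k
  proof (cases k)
    case None
    have "(\<lambda>F. cell_label F x) -` {k} \<inter> space cells_space
        = space cells_space - (\<Union>i. {F \<in> space cells_space. cell_label F x = Some i})"
      by (auto simp: None)
    then show ?thesis using some by auto
  next
    case (Some i)
    have "(\<lambda>F. cell_label F x) -` {k} \<inter> space cells_space
        = {F \<in> space cells_space. cell_label F x = Some i}"
      by (auto simp: Some)
    then show ?thesis using some by simp
  qed
  then show ?thesis
    by (subst measurable_count_space_eq_countable) auto
qed

lemma partition2_measurable: "partition2 \<in> cells_space \<rightarrow>\<^sub>M field_space"
proof -
  note [measurable] = tess_boundary_measurable cell_measurable[OF interior_measurable]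
  have "(\<lambda>F. \<lambda>p\<in>UNIV. partition2 F p) \<in> cells_space \<rightarrow>\<^sub>M field_space"
  proof (rule measurable_restrict)
    fix p :: "(real^2) \<times> (real^2)"
    show "(\<lambda>F. partition2 F p) \<in> borel_measurable cells_space"
      unfolding partition2_def Diff_iff by measurable
  qed
  then show ?thesis by (simp add: restrict_UNIV)
qed

section \<open>The limit of the colored tessellation processes\<close>

lemma distr_pair_independent:
  assumes M: "prob_space M" and ind: "independent_elements M S X S' Y"
  shows "distr M (S \<Otimes>\<^sub>M S') (\<lambda>w. (X w, Y w)) = distr M S X \<Otimes>\<^sub>M distr M S' Y"
proof -
  interpret prob_space M by fact
  have X: "X \<in> M \<rightarrow>\<^sub>M S" and Y: "Y \<in> M \<rightarrow>\<^sub>M S'"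
    and i: "indep_set {X -` A \<inter> space M | A. A \<in> sets S} {Y -` B \<inter> space M | B. B \<in> sets S'}"
    using ind by (auto simp: independent_elements_def)
  have XY: "(\<lambda>w. (X w, Y w)) \<in> M \<rightarrow>\<^sub>M S \<Otimes>\<^sub>M S'" using X Y by (rule measurable_Pair)
  interpret DX: prob_space "distr M S X" using X by (rule prob_space_distr)
  interpret DY: prob_space "distr M S' Y" using Y by (rule prob_space_distr)
  have "distr M S X \<Otimes>\<^sub>M distr M S' Y = distr M (S \<Otimes>\<^sub>M S') (\<lambda>w. (X w, Y w))"
  proof (rule pair_measure_eqI)
    show "sigma_finite_measure (distr M S X)" "sigma_finite_measure (distr M S' Y)" by unfold_locales
    show "sets (distr M S X \<Otimes>\<^sub>M distr M S' Y) = sets (distr M (S \<Otimes>\<^sub>M S') (\<lambda>w. (X w, Y w)))"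
      by (simp add: sets_pair_measure_cong[of "distr M S X" S "distr M S' Y" S'])
    fix A B assume "A \<in> sets (distr M S X)" "B \<in> sets (distr M S' Y)"
    then have A: "A \<in> sets S" and B: "B \<in> sets S'" by simp_all
    have "prob ((X -` A \<inter> space M) \<inter> (Y -` B \<inter> space M))
        = prob (X -` A \<inter> space M) * prob (Y -` B \<inter> space M)"
      by (rule indep_setD[OF i]) (use A B in blast)+
    moreover have "(X -` A \<inter> space M) \<inter> (Y -` B \<inter> space M) = (\<lambda>w. (X w, Y w)) -` (A \<times> B) \<inter> space M"
      by auto
    ultimately show "emeasure (distr M S X) A * emeasure (distr M S' Y) B
        = emeasure (distr M (S \<Otimes>\<^sub>M S') (\<lambda>w. (X w, Y w))) (A \<times> B)"
      using A B by (simp add: emeasure_distr X Y XY emeasure_eq_measure ennreal_mult'[symmetric])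
  qed
  then show ?thesis ..
qed

lemma colored_process_measurable:
  assumes T: "random_tessellation M T" and I: "colored_process M T C I"
  shows "I \<in> M \<rightarrow>\<^sub>M field_space"
proof -
  obtain Cc where Cc: "\<And>i. Cc i \<in> M \<rightarrow>\<^sub>M field_space"
    and I_eq: "\<And>w. w \<in> space M \<Longrightarrow> I w = colored (T w) (\<lambda>i. Cc i w)"
    using I unfolding colored_process_def by blast
  have Tm: "T \<in> M \<rightarrow>\<^sub>M cells_space" using T by (simp add: random_tessellation_def)
  have "(\<lambda>w. \<lambda>x\<in>UNIV. colored (T w) (\<lambda>i. Cc i w) x) \<in> M \<rightarrow>\<^sub>M field_space"
  proof (rule measurable_restrict)
    fix x :: "real^2"
    have "(\<lambda>w. \<lambda>i\<in>UNIV. Cc i w) \<in> M \<rightarrow>\<^sub>M PiM UNIV (\<lambda>_. field_space)"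
      by (rule measurable_restrict) (rule Cc)
    then have "(\<lambda>w. (T w, \<lambda>i. Cc i w)) \<in> M \<rightarrow>\<^sub>M cells_space \<Otimes>\<^sub>M PiM UNIV (\<lambda>_. field_space)"
      by (intro measurable_Pair Tm) (simp add: restrict_UNIV)
    from measurable_compose[OF this color_at_measurable[OF cell_label_measurable refl]]
    show "(\<lambda>w. colored (T w) (\<lambda>i. Cc i w) x) \<in> borel_measurable M"
      by (simp add: colored_eq_color_at)
  qed
  then have "(\<lambda>w. colored (T w) (\<lambda>i. Cc i w)) \<in> M \<rightarrow>\<^sub>M field_space" by (simp add: restrict_UNIV)
  then show ?thesis by (subst measurable_cong[OF I_eq])
qed

text \<open>The product functional of a colored tessellation is a finite sum, over the relations on \<open>J\<close>,
  of a product of means of the field over subsets of \<open>J\<close> times the probability that the pattern is this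
  relation.  Each of these quantities is a product functional of a finite-dimensional distribution of \<open>C\<close> or of the partition process.\<close>

lemma integral_colored_process:
  fixes h :: "real^2 \<Rightarrow> real \<Rightarrow> real"
  assumes T: "random_tessellation M T" and C: "random_field M C" and I: "colored_process M T C I"
    and J: "finite J" and h: "\<And>x. h x \<in> bcontfun"
  shows "(\<integral>w. (\<Prod>x\<in>J. h x (I w x)) \<partial>M) =
    (\<Sum>Q\<in>Pow (J \<times> J). pattern_mean J h (\<lambda>B. \<integral>w. (\<Prod>x\<in>B. h x (C w x)) \<partial>M) Q
       * (\<integral>w. (\<Prod>p\<in>J \<times> J. pattern_factor Q p (partition2 (T w) p)) \<partial>M))"
proof -
  have M: "prob_space M" and Tm: "T \<in> M \<rightarrow>\<^sub>M cells_space" and tess: "AE w in M. tessellation (T w)"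
    using T by (simp_all add: random_tessellation_def)
  have Cm: "C \<in> M \<rightarrow>\<^sub>M field_space" using C by (simp add: random_field_def)
  interpret prob_space M by fact
  obtain Cc where Cc: "\<And>i. Cc i \<in> M \<rightarrow>\<^sub>M field_space"
    and law: "\<And>i. distr M field_space (Cc i) = distr M field_space C"
    and ind: "indep_vars (\<lambda>_. field_space) Cc UNIV"
    and indT: "independent_elements M cells_space T (PiM UNIV (\<lambda>_. field_space)) (\<lambda>w i. Cc i w)"
    and I_eq: "\<And>w. w \<in> space M \<Longrightarrow> I w = colored (T w) (\<lambda>i. Cc i w)"
    using I unfolding colored_process_def by blast
  define D where "D = distr M field_space C"
  have D: "prob_space D" "sets D = sets field_space"
    unfolding D_def by (auto intro: prob_space_distr Cm)
  let ?S = "PiM UNIV (\<lambda>_ :: nat. field_space :: (real^2 \<Rightarrow> real) measure)"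
  let ?N = "PiM UNIV (\<lambda>_ :: nat. D)"
  have "distr M ?S (\<lambda>w. \<lambda>i\<in>UNIV. Cc i w) = PiM UNIV (\<lambda>i. distr M field_space (Cc i))"
    using ind Cc by (subst indep_vars_iff_distr_eq_PiM[symmetric]) auto
  then have colors: "distr M ?S (\<lambda>w i. Cc i w) = ?N"
    by (simp add: law D_def restrict_UNIV)
  let ?P = "distr M cells_space T"
  have P: "prob_space ?P" using Tm by (rule prob_space_distr)
  have joint: "distr M (cells_space \<Otimes>\<^sub>M ?S) (\<lambda>w. (T w, \<lambda>i. Cc i w)) = ?P \<Otimes>\<^sub>M ?N"
    using distr_pair_independent[OF M indT] by (simp add: colors)
  have pair: "(\<lambda>w. (T w, \<lambda>i. Cc i w)) \<in> M \<rightarrow>\<^sub>M cells_space \<Otimes>\<^sub>M ?S"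
    using indT unfolding independent_elements_def by (intro measurable_Pair) auto
  let ?f = "\<lambda>z. \<Prod>x\<in>J. h x (color_at (snd z) (cell_label (fst z)) x)"
  have f: "?f \<in> borel_measurable (cells_space \<Otimes>\<^sub>M ?S)"
    by (intro borel_measurable_prod
        measurable_compose[OF color_at_measurable[OF cell_label_measurable refl] bcontfun_measurable[OF h]])
  let ?m = "\<lambda>B. \<integral>c. (\<Prod>x\<in>B. h x (c x)) \<partial>D"
  have m: "?m B = (\<integral>w. (\<Prod>x\<in>B. h x (C w x)) \<partial>M)" for B
    unfolding D_def by (rule integral_distr[OF Cm product_test_measurable]) (use h in auto)
  have R: "(\<lambda>w. partition2 (T w)) \<in> M \<rightarrow>\<^sub>M field_space"
    by (rule measurable_compose[OF Tm partition2_measurable])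
  have pat: "(\<lambda>F. pattern J (cell_label F)) \<in> cells_space \<rightarrow>\<^sub>M count_space (Pow (J \<times> J))"
    by (rule pattern_measurable[OF cell_label_measurable J])
  have lm: "(\<lambda>F. cell_label F x) \<in> ?P \<rightarrow>\<^sub>M count_space UNIV" for x
    using cell_label_measurable[of x] by simp
  have "(\<integral>w. (\<Prod>x\<in>J. h x (I w x)) \<partial>M) = (\<integral>w. ?f (T w, \<lambda>i. Cc i w) \<partial>M)"
    by (rule Bochner_Integration.integral_cong) (simp_all add: I_eq colored_eq_color_at)
  also have "\<dots> = (\<integral>z. ?f z \<partial>(?P \<Otimes>\<^sub>M ?N))"
    unfolding joint[symmetric] by (rule integral_distr[OF pair f, symmetric])
  also have "\<dots> = (\<integral>F. pattern_mean J h ?m (pattern J (cell_label F)) \<partial>?P)"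
    by (rule integral_random_pattern[where h = h, OF P D J h lm])
  also have "\<dots> = (\<integral>w. pattern_mean J h ?m (pattern J (cell_label (T w))) \<partial>M)"
  proof (rule integral_distr[OF Tm])
    show "(\<lambda>F. pattern_mean J h ?m (pattern J (cell_label F))) \<in> borel_measurable cells_space"
      by (rule measurable_compose[OF pat]) simp
  qed
  also have "\<dots> = (\<integral>w. pattern_mean J h ?m {p \<in> J \<times> J. partition2 (T w) p = 1} \<partial>M)"
  proof (rule integral_cong_AE)
    show "AE w in M. pattern_mean J h ?m (pattern J (cell_label (T w)))
        = pattern_mean J h ?m {p \<in> J \<times> J. partition2 (T w) p = 1}"
      using tess by eventually_elim (simp add: pattern_cell_label)
    show "(\<lambda>w. pattern_mean J h ?m (pattern J (cell_label (T w)))) \<in> borel_measurable M"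
      by (rule measurable_compose[OF measurable_compose[OF Tm pat]]) simp
    show "(\<lambda>w. pattern_mean J h ?m {p \<in> J \<times> J. partition2 (T w) p = 1}) \<in> borel_measurable M"
      by (rule measurable_compose[OF level_set_measurable[OF R]]) (use J in auto)
  qed
  also have "\<dots> = (\<Sum>Q\<in>Pow (J \<times> J). pattern_mean J h ?m Q
       * (\<integral>w. (\<Prod>p\<in>J \<times> J. pattern_factor Q p (partition2 (T w) p)) \<partial>M))"
    by (rule integral_pattern_sum[OF M R]) (use J in \<open>auto simp: partition2_def\<close>)
  finally show ?thesis unfolding m .
qed


text \<open>The defining property of patterns survives in the limit in this form: the probability of a
  relation that is not a pattern is \<open>0\<close> for every random tessellation, hence for every limit of their
  partition processes.\<close>

lemma partition_pattern_null:
  assumes T: "random_tessellation M T" and J: "finite J"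
    and Q: "Q \<subseteq> J \<times> J" "Q \<notin> range (pattern J)"
  shows "(\<integral>w. (\<Prod>p\<in>J \<times> J. pattern_factor Q p (partition2 (T w) p)) \<partial>M) = 0"
proof -
  have tess: "AE w in M. tessellation (T w)" using T by (simp add: random_tessellation_def)
  have "AE w in M. (\<Prod>p\<in>J \<times> J. pattern_factor Q p (partition2 (T w) p)) = 0"
    using tess
  proof eventually_elim
    case (elim w)
    have "{p \<in> J \<times> J. partition2 (T w) p = 1} \<noteq> Q"
      using Q(2) pattern_cell_label[OF elim, of J] by auto
    then show ?case
      using J Q(1) by (subst prod_pattern_factor) (auto simp: partition2_def)
  qed
  then show ?thesis by (rule integral_eq_zero_AE)
qed

text \<open>Every factor of the finite sum converges by assumption, so the sum converges to the same
  expression in the limit objects.\<close>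

lemma colored_process_product_limit:
  fixes h :: "real^2 \<Rightarrow> real \<Rightarrow> real"
  assumes conv: "converging_coloring M T C I MR Rlim MC Clim"
    and J: "finite J" and h: "\<And>x. h x \<in> bcontfun"
  shows "(\<lambda>j. \<integral>w. (\<Prod>x\<in>J. h x (I j w x)) \<partial>M j) \<longlonglongrightarrow>
    (\<Sum>Q\<in>Pow (J \<times> J). pattern_mean J h (\<lambda>B. \<integral>w. (\<Prod>x\<in>B. h x (Clim w x)) \<partial>MC) Q
       * (\<integral>w. (\<Prod>p\<in>J \<times> J. pattern_factor Q p (Rlim w p)) \<partial>MR))"
proof -
  have T: "random_tessellation (M j) (T j)" and C: "random_field (M j) (C j)"
    and I: "colored_process (M j) (T j) (C j) (I j)" for j
    using conv by (simp_all add: converging_coloring_def)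
  have convR: "fdd_converges M (\<lambda>j w. partition2 (T j w)) MR Rlim"
    and convC: "fdd_converges M C MC Clim"
    and Rm: "Rlim \<in> MR \<rightarrow>\<^sub>M field_space" and Cm: "Clim \<in> MC \<rightarrow>\<^sub>M field_space"
    using conv by (simp_all add: converging_coloring_def random_field_def)
  have Rjm: "(\<lambda>w. partition2 (T j w)) \<in> M j \<rightarrow>\<^sub>M field_space" for j
    using T[of j] unfolding random_tessellation_def
    by (intro measurable_compose[OF _ partition2_measurable]) simp
  have Cjm: "C j \<in> M j \<rightarrow>\<^sub>M field_space" for j using C[of j] by (simp add: random_field_def)
  have JJ: "finite (J \<times> J)" using J by simp
  have "(\<lambda>j. \<Sum>Q\<in>Pow (J \<times> J). pattern_mean J h (\<lambda>B. \<integral>w. (\<Prod>x\<in>B. h x (C j w x)) \<partial>M j) Q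
       * (\<integral>w. (\<Prod>p\<in>J \<times> J. pattern_factor Q p (partition2 (T j w) p)) \<partial>M j)) \<longlonglongrightarrow>
    (\<Sum>Q\<in>Pow (J \<times> J). pattern_mean J h (\<lambda>B. \<integral>w. (\<Prod>x\<in>B. h x (Clim w x)) \<partial>MC) Q
       * (\<integral>w. (\<Prod>p\<in>J \<times> J. pattern_factor Q p (Rlim w p)) \<partial>MR))"
  proof (intro tendsto_sum tendsto_mult)
    fix Q assume "Q \<in> Pow (J \<times> J)"
    then show "(\<lambda>j. pattern_mean J h (\<lambda>B. \<integral>w. (\<Prod>x\<in>B. h x (C j w x)) \<partial>M j) Q) \<longlonglongrightarrow>
        pattern_mean J h (\<lambda>B. \<integral>w. (\<Prod>x\<in>B. h x (Clim w x)) \<partial>MC) Q"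
      by (intro tendsto_pattern_mean fdd_converges_productD[where h = h, OF convC _ h Cjm Cm]
          finite_subset[OF _ J]) simp_all
    show "(\<lambda>j. \<integral>w. (\<Prod>p\<in>J \<times> J. pattern_factor Q p (partition2 (T j w) p)) \<partial>M j) \<longlonglongrightarrow>
        (\<integral>w. (\<Prod>p\<in>J \<times> J. pattern_factor Q p (Rlim w p)) \<partial>MR)"
      by (rule fdd_converges_productD[where h = "pattern_factor Q", OF convR JJ pattern_factor_bcontfun Rjm Rm])
  qed
  then show ?thesis
    by (simp add: integral_colored_process[where h = h, OF T C I J h])
qed

lemma colored_process_limit_exists:
  assumes conv: "converging_coloring M T C I MR Rlim MC Clim"
  shows "\<exists>(N :: (real^2 \<Rightarrow> real) measure) Ilim. random_field N Ilim \<and> fdd_converges M I N Ilim"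
proof (rule fdd_limit_exists)
  have T: "random_tessellation (M j) (T j)"
    and I: "colored_process (M j) (T j) (C j) (I j)" for j
    using conv by (simp_all add: converging_coloring_def)
  have convR: "fdd_converges M (\<lambda>j w. partition2 (T j w)) MR Rlim"
    and MR: "prob_space MR" and Rm: "Rlim \<in> MR \<rightarrow>\<^sub>M field_space"
    and MC: "prob_space MC" and Cm: "Clim \<in> MC \<rightarrow>\<^sub>M field_space"
    using conv by (simp_all add: converging_coloring_def random_field_def)
  have R01: "Rlim w p \<in> {0, 1}" if "w \<in> space MR" for w p
    using conv that unfolding converging_coloring_def by blast
  have Rjm: "(\<lambda>w. partition2 (T j w)) \<in> M j \<rightarrow>\<^sub>M field_space" for j
    using T[of j] unfolding random_tessellation_def
    by (intro measurable_compose[OF _ partition2_measurable]) simp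
  show "random_field (M j) (I j)" for j
    using colored_process_measurable[OF T I] T[of j]
    by (simp add: random_field_def random_tessellation_def)
  fix J :: "(real^2) set" assume J: "finite J"
  define D where "D = distr MC field_space Clim"
  have D: "prob_space D" "sets D = sets field_space"
    unfolding D_def by (auto intro: prob_space.prob_space_distr[OF MC] Cm)
  have null: "(\<integral>w. (\<Prod>p\<in>J \<times> J. pattern_factor Q p (Rlim w p)) \<partial>MR) = 0"
    if Q: "Q \<subseteq> J \<times> J" "Q \<notin> range (pattern J)" for Q
  proof (rule LIMSEQ_unique)
    show "(\<lambda>j. \<integral>w. (\<Prod>p\<in>J \<times> J. pattern_factor Q p (partition2 (T j w) p)) \<partial>M j) \<longlonglongrightarrow>
        (\<integral>w. (\<Prod>p\<in>J \<times> J. pattern_factor Q p (Rlim w p)) \<partial>MR)"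
      by (rule fdd_converges_productD[where h = "pattern_factor Q", OF convR _ pattern_factor_bcontfun Rjm Rm])
         (use J in simp)
    show "(\<lambda>j. \<integral>w. (\<Prod>p\<in>J \<times> J. pattern_factor Q p (partition2 (T j w) p)) \<partial>M j) \<longlonglongrightarrow> 0"
      by (simp add: partition_pattern_null[OF T J Q])
  qed
  have "\<exists>\<mu>. prob_space \<mu> \<and> sets \<mu> = sets (PiM J (\<lambda>_. borel)) \<and>
    (\<forall>h :: real^2 \<Rightarrow> real \<Rightarrow> real. (\<forall>x. h x \<in> bcontfun) \<longrightarrow>
      (\<integral>z. (\<Prod>x\<in>J. h x (z x)) \<partial>\<mu>)
      = (\<Sum>Q\<in>Pow (J \<times> J). pattern_mean J h (\<lambda>B. \<integral>c. (\<Prod>x\<in>B. h x (c x)) \<partial>D) Q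
           * (\<integral>w. (\<Prod>p\<in>J \<times> J. pattern_factor Q p (Rlim w p)) \<partial>MR)))"
    by (rule coloring_of_random_pattern[OF MR Rm _ D J]) (rule R01 null; assumption)+
  then obtain \<mu> where \<mu>: "prob_space \<mu>" "sets \<mu> = sets (PiM J (\<lambda>_. borel))"
    and \<mu>_prod: "\<forall>h :: real^2 \<Rightarrow> real \<Rightarrow> real. (\<forall>x. h x \<in> bcontfun) \<longrightarrow>
      (\<integral>z. (\<Prod>x\<in>J. h x (z x)) \<partial>\<mu>)
      = (\<Sum>Q\<in>Pow (J \<times> J). pattern_mean J h (\<lambda>B. \<integral>c. (\<Prod>x\<in>B. h x (c x)) \<partial>D) Q
           * (\<integral>w. (\<Prod>p\<in>J \<times> J. pattern_factor Q p (Rlim w p)) \<partial>MR))"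
    by (elim exE conjE) (rule that)
  show "\<exists>\<mu>. prob_space \<mu> \<and> sets \<mu> = sets (PiM J (\<lambda>_. borel)) \<and>
      (\<forall>h :: real^2 \<Rightarrow> real \<Rightarrow> real. (\<forall>x. h x \<in> bcontfun) \<longrightarrow>
        (\<lambda>j. \<integral>w. (\<Prod>x\<in>J. h x (I j w x)) \<partial>M j) \<longlonglongrightarrow> (\<integral>z. (\<Prod>x\<in>J. h x (z x)) \<partial>\<mu>))"
  proof (intro exI[of _ \<mu>] conjI allI impI \<mu>)
    fix h :: "real^2 \<Rightarrow> real \<Rightarrow> real" assume h: "\<forall>x. h x \<in> bcontfun"
    have m: "(\<integral>c. (\<Prod>x\<in>B. h x (c x)) \<partial>D) = (\<integral>w. (\<Prod>x\<in>B. h x (Clim w x)) \<partial>MC)" for B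
      unfolding D_def by (rule integral_distr[OF Cm product_test_measurable]) (use h in auto)
    show "(\<lambda>j. \<integral>w. (\<Prod>x\<in>J. h x (I j w x)) \<partial>M j) \<longlonglongrightarrow> (\<integral>z. (\<Prod>x\<in>J. h x (z x)) \<partial>\<mu>)"
      using colored_process_product_limit[where h = h, OF conv J] h \<mu>_prod[rule_format, of h]
      unfolding m by simp
  qed
qed

lemma same_fdds_integral_product:
  fixes h :: "'i \<Rightarrow> real \<Rightarrow> real"
  assumes "same_fdds M X N Y" "random_field M X" "random_field N Y" "finite J" "\<And>x. h x \<in> bcontfun"
  shows "(\<integral>w. (\<Prod>x\<in>J. h x (X w x)) \<partial>M) = (\<integral>w. (\<Prod>x\<in>J. h x (Y w x)) \<partial>N)"
proof -
  have "fdd M X J = fdd N Y J" using assms(1,4) by (simp add: same_fdds_def)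
  then show ?thesis
    using integral_fdd_product[of X M h J] integral_fdd_product[of Y N h J] assms
    by (simp add: random_field_def)
qed

text \<open>The limiting product functionals are expressed by finite-dimensional distributions of the
  partition process and of the field alone, and product functionals determine a law.\<close>

lemma colored_process_limit_unique:
  assumes conv: "converging_coloring M T C I MR Rlim MC Clim"
    and conv': "converging_coloring M' T' C' I' MR' Rlim' MC' Clim'"
    and R: "same_fdds MR Rlim MR' Rlim'" and C: "same_fdds MC Clim MC' Clim'"
    and N: "random_field N Ilim" "fdd_converges M I N Ilim"
    and N': "random_field N' Ilim'" "fdd_converges M' I' N' Ilim'"
  shows "same_fdds N Ilim N' Ilim'"
  unfolding same_fdds_def
proof (intro allI impI)
  fix J :: "(real^2) set" assume J: "finite J"
  have Im: "I j \<in> M j \<rightarrow>\<^sub>M field_space" for j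
    using conv by (auto simp: converging_coloring_def intro: colored_process_measurable)
  have Im': "I' j \<in> M' j \<rightarrow>\<^sub>M field_space" for j
    using conv' by (auto simp: converging_coloring_def intro: colored_process_measurable)
  have fields: "random_field MR Rlim" "random_field MC Clim" "random_field MR' Rlim'" "random_field MC' Clim'"
    using conv conv' by (simp_all add: converging_coloring_def)
  have Nm: "prob_space N" "Ilim \<in> N \<rightarrow>\<^sub>M field_space" "prob_space N'" "Ilim' \<in> N' \<rightarrow>\<^sub>M field_space"
    using N(1) N'(1) by (simp_all add: random_field_def)
  show "fdd N Ilim J = fdd N' Ilim' J"
  proof (rule measure_eqI_products[OF J prob_space_fdd[OF Nm(1,2)] sets_fdd prob_space_fdd[OF Nm(3,4)] sets_fdd])
    fix h :: "real^2 \<Rightarrow> real \<Rightarrow> real" assume h: "\<And>x. h x \<in> bcontfun"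
    let ?L = "\<Sum>Q\<in>Pow (J \<times> J). pattern_mean J h (\<lambda>B. \<integral>w. (\<Prod>x\<in>B. h x (Clim w x)) \<partial>MC) Q
       * (\<integral>w. (\<Prod>p\<in>J \<times> J. pattern_factor Q p (Rlim w p)) \<partial>MR)"
    let ?L' = "\<Sum>Q\<in>Pow (J \<times> J). pattern_mean J h (\<lambda>B. \<integral>w. (\<Prod>x\<in>B. h x (Clim' w x)) \<partial>MC') Q
       * (\<integral>w. (\<Prod>p\<in>J \<times> J. pattern_factor Q p (Rlim' w p)) \<partial>MR')"
    have "?L = ?L'"
    proof (intro sum.cong refl arg_cong2[where f = "(*)"])
      fix Q assume "Q \<in> Pow (J \<times> J)"
      then show "pattern_mean J h (\<lambda>B. \<integral>w. (\<Prod>x\<in>B. h x (Clim w x)) \<partial>MC) Q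
          = pattern_mean J h (\<lambda>B. \<integral>w. (\<Prod>x\<in>B. h x (Clim' w x)) \<partial>MC') Q"
        by (intro pattern_mean_cong same_fdds_integral_product[where h = h, OF C fields(2,4) _ h]
            finite_subset[OF _ J]) simp_all
      show "(\<integral>w. (\<Prod>p\<in>J \<times> J. pattern_factor Q p (Rlim w p)) \<partial>MR)
          = (\<integral>w. (\<Prod>p\<in>J \<times> J. pattern_factor Q p (Rlim' w p)) \<partial>MR')"
        by (rule same_fdds_integral_product[where h = "pattern_factor Q", OF R fields(1,3) _ pattern_factor_bcontfun])
           (use J in simp)
    qed
    moreover have "(\<integral>w. (\<Prod>x\<in>J. h x (Ilim w x)) \<partial>N) = ?L"
      by (rule LIMSEQ_unique[OF fdd_converges_productD[where h = h, OF N(2) J h Im Nm(2)]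
            colored_process_product_limit[where h = h, OF conv J h]])
    moreover have "(\<integral>w. (\<Prod>x\<in>J. h x (Ilim' w x)) \<partial>N') = ?L'"
      by (rule LIMSEQ_unique[OF fdd_converges_productD[where h = h, OF N'(2) J h Im' Nm(4)]
            colored_process_product_limit[where h = h, OF conv' J h]])
    ultimately show "(\<integral>z. (\<Prod>x\<in>J. h x (z x)) \<partial>fdd N Ilim J) = (\<integral>z. (\<Prod>x\<in>J. h x (z x)) \<partial>fdd N' Ilim' J)"
      using h by (simp add: integral_fdd_product Nm)
  qed
qed

theorem theorem1:
  fixes M :: "nat \<Rightarrow> 'a measure" and T :: "nat \<Rightarrow> 'a \<Rightarrow> nat \<Rightarrow> (real^2) set"
    and C I :: "nat \<Rightarrow> 'a \<Rightarrow> real^2 \<Rightarrow> real"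
    and MR :: "'r measure" and Rlim :: "'r \<Rightarrow> (real^2) \<times> (real^2) \<Rightarrow> real"
    and MC :: "'c measure" and Clim :: "'c \<Rightarrow> real^2 \<Rightarrow> real"
  assumes "converging_coloring M T C I MR Rlim MC Clim"
  shows "(\<exists>(N :: (real^2 \<Rightarrow> real) measure) Ilim. random_field N Ilim \<and> fdd_converges M I N Ilim) \<and>
    (\<forall>(M' :: nat \<Rightarrow> 'a2 measure) T' C' I' (MR' :: 'r2 measure) Rlim' (MC' :: 'c2 measure) Clim'
        (N :: 'n measure) Ilim (N' :: 'n2 measure) Ilim'.
       converging_coloring M' T' C' I' MR' Rlim' MC' Clim' \<longrightarrow>
       same_fdds MR Rlim MR' Rlim' \<longrightarrow> same_fdds MC Clim MC' Clim' \<longrightarrow>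
       random_field N Ilim \<longrightarrow> fdd_converges M I N Ilim \<longrightarrow>
       random_field N' Ilim' \<longrightarrow> fdd_converges M' I' N' Ilim' \<longrightarrow>
       same_fdds N Ilim N' Ilim')"
proof (rule conjI)
  show "\<exists>(N :: (real^2 \<Rightarrow> real) measure) Ilim. random_field N Ilim \<and> fdd_converges M I N Ilim"
    by (rule colored_process_limit_exists[OF assms])
qed (intro allI impI, rule colored_process_limit_unique[OF assms]; assumption)

end
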